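(* Let $m\geqslant 3$ and $n\geqslant 3$ be distinct odd integers. Then the number of distinct $C_4$-face-magic projective labelings on $\mathcal{P}_{m,n}$, counted up to symmetries of the projective plane, is at least $\bigl(\tau(m,n)+\tau(n,m)\bigr)\,2^{m/2+n/2-3}\Bigl(\bigl(\tfrac{m-1}{2}\bigr)!\,\bigl(\tfrac{n-1}{2}\bigr)!+2\,\beta(m)\,\beta(n)\Bigr)$.
   Context: $\mathcal{P}_{m,n}$ has vertices $(i,j)$, $1\leqslant i\leqslant m$, $1\leqslant j\leqslant n$, and edges $(i,j)$–$(i,j+1)$ ($j\leqslant n-1$), $(i,n)$–$(m+1-i,1)$, $(i,j)$–$(i+1,j)$ ($i\leqslant m-1$), $(m,j)$–$(1,n+1-j)$, embedded naturally in the projective plane. Its 4-cycle faces are $\{(i,j),(i+1,j),(i,j+1),(i+1,j+1)\}$ ($1\leqslant i\leqslant m-1$, $1\leqslant j\leqslant n-1$), $\{(i,n),(i+1,n),(m+1-i,1),(m-i,1)\}$ ($1\leqslant i\leqslant m-1$), $\{(m,j),(m,j+1),(1,n+1-j),(1,n-j)\}$ ($1\leqslant j\leqslant n-1$); the other two faces are digons. A $C_4$-face-magic projective labeling is a bijection from the vertices onto $\{1,\ldots,mn\}$ such that every 4-cycle face has the same label sum. For $m\neq n$ the symmetries of $\mathcal{P}_{m,n}$ are the four automorphisms $(i,j)\mapsto(i,j)$, $(m+1-i,n+1-j)$, $(i,n+1-j)$, $(m+1-i,j)$; labelings are counted up to precomposition with these. For positive integer $k$, an $(m,n)$-projective factorization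 sequence is a tuple $(m_1,n_1,\ldots,m_k,n_k)$ of integers $>1$ with $m=m_1\cdots m_k$, $n=n_1\cdots n_k$, or a tuple $(m_1,n_1,\ldots,m_k,n_k,m_{k+1})$ of integers $>1$ with $m=m_1\cdots m_{k+1}$, $n=n_1\cdots n_k$; $\tau(m,n)$ is the number of distinct such sequences, and $\tau(n,m)$ is defined with $m$ and $n$ exchanged. For odd $m\geqslant3$, $\beta(m)=\bigl((\tfrac{m-1}{4})!\bigr)^2$ if $m\equiv1\pmod4$ and $\beta(m)=(\tfrac{m-3}{4})!\,(\tfrac{m+1}{4})!$ if $m\equiv3\pmod4$. *)

theory Defs
  imports Complex_Main "HOL-Library.FuncSet"
begin

definition proj_vertices :: "nat \<Rightarrow> nat \<Rightarrow> (nat \<times> nat) set" where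
  "proj_vertices m n = {1..m} \<times> {1..n}"

text \<open>The faces bounded by 4-cycles, each given by its set of vertices. For \<open>m, n \<ge> 2\<close> every such
  set has exactly four elements, so summing a labeling over it counts each corner once.\<close>

definition proj_C4_faces :: "nat \<Rightarrow> nat \<Rightarrow> (nat \<times> nat) set set" where
  "proj_C4_faces m n =
     {{(i, j), (i + 1, j), (i, j + 1), (i + 1, j + 1)} | i j. i \<in> {1..m - 1} \<and> j \<in> {1..n - 1}}
   \<union> {{(i, n), (i + 1, n), (m + 1 - i, 1), (m - i, 1)} | i. i \<in> {1..m - 1}}
   \<union> {{(m, j), (m, j + 1), (1, n + 1 - j), (1, n - j)} | j. j \<in> {1..n - 1}}"

text \<open>A labeling is a function on the vertex set only; membership in \<open>extensional\<close> fixes the value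
  off the vertex set, so that distinct labelings are distinct HOL functions.\<close>

definition C4_face_magic_labelings :: "nat \<Rightarrow> nat \<Rightarrow> (nat \<times> nat \<Rightarrow> nat) set" where
  "C4_face_magic_labelings m n =
     {f \<in> extensional (proj_vertices m n).
        bij_betw f (proj_vertices m n) {1..m * n} \<and>
        (\<exists>S. \<forall>F \<in> proj_C4_faces m n. sum f F = S)}"

text \<open>The symmetry group in the case \<open>m \<noteq> n\<close>.\<close>

definition proj_symmetries :: "nat \<Rightarrow> nat \<Rightarrow> (nat \<times> nat \<Rightarrow> nat \<times> nat) set" where
  "proj_symmetries m n =
     {\<lambda>(i, j). (i, j),
      \<lambda>(i, j). (m + 1 - i, n + 1 - j),
      \<lambda>(i, j). (i, n + 1 - j),
      \<lambda>(i, j). (m + 1 - i, j)}"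

definition symmetry_equiv ::
  "nat \<Rightarrow> nat \<Rightarrow> ((nat \<times> nat \<Rightarrow> nat) \<times> (nat \<times> nat \<Rightarrow> nat)) set" where
  "symmetry_equiv m n =
     {(f, g). f \<in> C4_face_magic_labelings m n \<and> g \<in> C4_face_magic_labelings m n \<and>
        (\<exists>\<sigma> \<in> proj_symmetries m n. g = restrict (f \<circ> \<sigma>) (proj_vertices m n))}"

definition num_C4_face_magic_labelings :: "nat \<Rightarrow> nat \<Rightarrow> nat" where
  "num_C4_face_magic_labelings m n = card (C4_face_magic_labelings m n // symmetry_equiv m n)"

text \<open>The tuple \<open>(m\<^sub>1, n\<^sub>1, m\<^sub>2, n\<^sub>2, \<dots>)\<close> is a list indexed from 0, so that \<open>m\<^sub>i\<^sub>+\<^sub>1\<close> is at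
  position \<open>2 * i\<close> and \<open>n\<^sub>i\<^sub>+\<^sub>1\<close> at position \<open>2 * i + 1\<close>.\<close>

definition proj_factorization_seqs :: "nat \<Rightarrow> nat \<Rightarrow> nat list set" where
  "proj_factorization_seqs m n =
     {xs. (\<forall>x \<in> set xs. x > 1) \<and>
        (\<exists>k \<ge> 1.
           (length xs = 2 * k \<and> m = (\<Prod>i<k. xs ! (2 * i)) \<and> n = (\<Prod>i<k. xs ! (2 * i + 1)))
         \<or> (length xs = 2 * k + 1 \<and> m = (\<Prod>i<k + 1. xs ! (2 * i)) \<and> n = (\<Prod>i<k. xs ! (2 * i + 1))))}"

definition tau :: "nat \<Rightarrow> nat \<Rightarrow> nat" where
  "tau m n = card (proj_factorization_seqs m n)"

text \<open>Only meant for odd \<open>m \<ge> 3\<close>, where the second branch is the case \<open>m mod 4 = 3\<close>.\<close>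

definition beta :: "nat \<Rightarrow> nat" where
  "beta m = (if m mod 4 = 1 then (fact ((m - 1) div 4))\<^sup>2
             else fact ((m - 3) div 4) * fact ((m + 1) div 4))"

end

theory Submission
  imports Defs "HOL-Combinatorics.Permutations"
begin

text \<open>In coordinates \<open>(i, j)\<close> centred at the middle vertex, put \<open>v(i, j) = (-1)^(i+j) (a i + b j)\<close> with odd
  functions \<open>a\<close> and \<open>b\<close>. Then \<open>v\<close> sums to 0 over every 4-cycle face: on the faces crossing the boundary
  because \<open>v\<close> is odd under the antipodal map. Its values are those of \<open>a i + b j\<close>, so a labeling arises
  whenever the ranges \<open>A\<close> and \<open>B\<close> of \<open>a\<close> and \<open>b\<close> form a direct sum decomposition of the \<open>mn\<close> integers
  centred at 0. Factorization sequences give \<open>\<tau>(m,n) + \<tau>(n,m)\<close> such decompositions into symmetric sets,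
  by splitting the digit positions of a mixed radix system alternately. Each set is enumerated by
  \<open>2^((m-1)/2) ((m-1)/2)!\<close> odd functions, of which \<open>2^((m-1)/2) \<beta>(m)\<close> satisfy \<open>a i \<equiv> i (mod 2)\<close>. When
  both \<open>a\<close> and \<open>b\<close> do, every face carries two even and two odd values, and two further labelings are
  obtained by giving the even values the smallest or the largest labels. Finally, symmetry classes have
  at most four elements.\<close>

section \<open>Direct sum decompositions of centred intervals\<close>

text \<open>For odd \<open>x\<close> this is the set of \<open>x\<close> consecutive integers centred at 0.\<close>

definition cint :: "nat \<Rightarrow> int set" where
  "cint x = {- int (x div 2)..int (x div 2)}"

lemma finite_cint [simp]: "finite (cint x)"
  by (simp add: cint_def)

lemma zero_in_cint [simp]: "0 \<in> cint x"
  by (simp add: cint_def)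

lemma uminus_in_cint_iff [simp]: "- i \<in> cint x \<longleftrightarrow> i \<in> cint x"
  by (auto simp: cint_def)

lemma card_cint: "odd x \<Longrightarrow> card (cint x) = x"
  by (auto simp: cint_def elim!: oddE)

text \<open>Division with remainder, the remainders being centred at 0. Two elements of
  \<open>cint x\<close> differ by less than \<open>x\<close>, so congruent ones are equal.
  Surjectivity then follows by comparing cardinalities.\<close>

lemma bij_betw_mixed_radix:
  assumes "odd x" "odd y"
  shows "bij_betw (\<lambda>(r, q). r + int x * q) (cint x \<times> cint y) (cint (x * y))"
proof -
  let ?f = "\<lambda>(r, q). r + int x * q"
  obtain u where u: "x = 2 * u + 1" using assms(1) by (elim oddE)
  obtain w where w: "y = 2 * w + 1" using assms(2) by (elim oddE)
  have xy: "x * y = 2 * (2 * u * w + u + w) + 1" by (simp add: u w algebra_simps)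
  have inj: "inj_on ?f (cint x \<times> cint y)"
  proof (rule inj_onI, clarify)
    fix r q r' q'
    assume r: "r \<in> cint x" "r' \<in> cint x" and eq: "r + int x * q = r' + int x * q'"
    have d: "r - r' = int x * (q' - q)" using eq by (simp add: algebra_simps)
    have "\<bar>r - r'\<bar> < int x" using r by (auto simp: cint_def u)
    moreover have "int x dvd r - r'" using d by simp
    ultimately have "r - r' = 0" using dvd_imp_le_int[of "r - r'" "int x"] by fastforce
    with d u show "r = r' \<and> q = q'" by simp
  qed
  have sub: "?f ` (cint x \<times> cint y) \<subseteq> cint (x * y)"
  proof clarify
    fix r q assume r: "r \<in> cint x" and q: "q \<in> cint y"
    have "\<bar>r + int x * q\<bar> \<le> \<bar>r\<bar> + \<bar>int x * q\<bar>" by (rule abs_triangle_ineq)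
    also have "\<dots> = \<bar>r\<bar> + int x * \<bar>q\<bar>" by (simp add: abs_mult)
    also have "\<dots> \<le> int u + int x * int w"
      using r q by (intro add_mono mult_left_mono) (auto simp: cint_def u w)
    also have "\<dots> = int (2 * u * w + u + w)" by (simp add: u algebra_simps)
    finally show "r + int x * q \<in> cint (x * y)" unfolding cint_def xy by auto
  qed
  have "?f ` (cint x \<times> cint y) = cint (x * y)"
    using sub by (rule card_subset_eq[rotated])
      (simp_all add: card_image[OF inj] card_cartesian_product card_cint assms)
  with inj show ?thesis by (simp add: bij_betw_def)
qed

section \<open>Decompositions of a centred interval into two symmetric summands\<close>

definition sym_factorization :: "nat \<Rightarrow> nat \<Rightarrow> int set \<Rightarrow> int set \<Rightarrow> bool" where
  "sym_factorization m n A B \<longleftrightarrow>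
     0 \<in> A \<and> 0 \<in> B \<and> (\<forall>x\<in>A. - x \<in> A) \<and> (\<forall>x\<in>B. - x \<in> B) \<and> card A = m \<and> card B = n \<and>
     bij_betw (\<lambda>(a, b). a + b) (A \<times> B) (cint (m * n))"

lemma sym_factorization_commute:
  assumes "sym_factorization m n A B"
  shows "sym_factorization n m B A"
proof -
  have "bij_betw (\<lambda>(a, b). a + b) (A \<times> B) (cint (m * n))"
    using assms by (simp add: sym_factorization_def)
  moreover have "bij_betw prod.swap (B \<times> A) (A \<times> B)"
    by (auto simp: bij_betw_def inj_on_def)
  ultimately have "bij_betw ((\<lambda>(a, b). a + b) \<circ> prod.swap) (B \<times> A) (cint (m * n))"
    by (blast intro: bij_betw_trans)
  moreover have "(\<lambda>(a, b). a + b) \<circ> prod.swap = (\<lambda>(a, b). a + b :: int)"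
    by (auto simp: fun_eq_iff)
  ultimately show ?thesis using assms by (simp add: sym_factorization_def mult.commute)
qed

text \<open>The centred interval of size \<open>x * (s * t)\<close> is the direct sum of
  \<open>cint x\<close>, \<open>x P\<close> and \<open>x Q\<close>. Grouping \<open>cint x\<close>
  with \<open>x Q\<close> leaves \<open>x P\<close> as the other summand, so the two roles are
  exchanged.\<close>

lemma sym_factorization_extend:
  assumes st: "sym_factorization s t P Q" and odd: "odd x" "odd s" "odd t"
  shows "sym_factorization (x * t) s
    ((\<lambda>(r, q). r + int x * q) ` (cint x \<times> Q)) ((\<lambda>p. int x * p) ` P)"
proof -
  let ?f = "\<lambda>(r, q). r + int x * q"
  let ?g = "\<lambda>p. int x * p"
  have x0: "x \<noteq> 0" using odd(1) by (rule contrapos_nn) simp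
  note S = st[unfolded sym_factorization_def]
  have bij: "bij_betw (\<lambda>(a, b). a + b) (P \<times> Q) (cint (s * t))" using S by simp
  have mix: "bij_betw ?f (cint x \<times> cint (s * t)) (cint (x * (s * t)))"
    using odd by (intro bij_betw_mixed_radix) auto
  have in_st: "p + q \<in> cint (s * t)" if "p \<in> P" "q \<in> Q" for p q
    using bij_betwE[OF bij] that by auto
  \<comment> \<open>Uniqueness of a sum with three parts: the mixed radix expansion determines
    \<open>r\<close> and \<open>p + q\<close>, and the given decomposition then separates
    \<open>p\<close> from \<open>q\<close>. The case \<open>p = p' = 0\<close> yields
    \<open>injf\<close>.\<close>
  have mixD: "r = r' \<and> p = p' \<and> q = q'"
    if "r \<in> cint x" "r' \<in> cint x" "p \<in> P" "p' \<in> P" "q \<in> Q" "q' \<in> Q"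
      and eq: "r + int x * (p + q) = r' + int x * (p' + q')" for r r' p p' q q'
  proof -
    have "(r, p + q) = (r', p' + q')"
      by (rule inj_onD[OF bij_betw_imp_inj_on[OF mix]]) (use that in_st in auto)
    moreover from this have "(p, q) = (p', q')"
      using that by (intro inj_onD[OF bij_betw_imp_inj_on[OF bij]]) auto
    ultimately show ?thesis by simp
  qed
  have injf: "inj_on ?f (cint x \<times> Q)"
  proof (rule inj_onI, clarify)
    fix r q r' q' assume "r \<in> cint x" "r' \<in> cint x" "q \<in> Q" "q' \<in> Q"
      and "r + int x * q = r' + int x * q'"
    then show "r = r' \<and> q = q'" using mixD[of r r' 0 0 q q'] S by simp
  qed
  have injg: "inj_on ?g P" using x0 by (auto simp: inj_on_def)
  have cardA: "card (?f ` (cint x \<times> Q)) = x * t"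
    using S odd by (simp add: card_image[OF injf] card_cartesian_product card_cint)
  have cardB: "card (?g ` P) = s"
    using S by (simp add: card_image[OF injg])
  have inj: "inj_on (\<lambda>(a, b). a + b) (?f ` (cint x \<times> Q) \<times> ?g ` P)"
  proof (rule inj_onI, clarify)
    fix r q p r' q' p'
    assume *: "r \<in> cint x" "q \<in> Q" "p \<in> P" "r' \<in> cint x" "q' \<in> Q" "p' \<in> P"
      and "r + int x * q + int x * p = r' + int x * q' + int x * p'"
    then have "r + int x * (p + q) = r' + int x * (p' + q')" by (simp add: algebra_simps)
    with * mixD[of r r' p p' q q'] show "r + int x * q = r' + int x * q' \<and> int x * p = int x * p'"
      by simp
  qed
  have sub: "(\<lambda>(a, b). a + b) ` (?f ` (cint x \<times> Q) \<times> ?g ` P) \<subseteq> cint (x * t * s)"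
  proof clarify
    fix r q p assume *: "r \<in> cint x" "q \<in> Q" "p \<in> P"
    then have "?f (r, p + q) \<in> cint (x * (s * t))"
      using in_st bij_betwE[OF mix] by blast
    then show "r + int x * q + int x * p \<in> cint (x * t * s)"
      by (simp add: algebra_simps)
  qed
  have "(\<lambda>(a, b). a + b) ` (?f ` (cint x \<times> Q) \<times> ?g ` P) = cint (x * t * s)"
    using sub by (rule card_subset_eq[rotated])
      (simp_all add: card_image[OF inj] card_cartesian_product cardA cardB card_cint odd)
  with inj have "bij_betw (\<lambda>(a, b). a + b) (?f ` (cint x \<times> Q) \<times> ?g ` P) (cint (x * t * s))"
    by (simp add: bij_betw_def)
  moreover have "0 \<in> ?f ` (cint x \<times> Q)" using S by (force intro: image_eqI[of _ _ "(0, 0)"])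
  moreover have "0 \<in> ?g ` P" using S by force
  moreover have "- y \<in> ?f ` (cint x \<times> Q)" if "y \<in> ?f ` (cint x \<times> Q)" for y
  proof -
    from that obtain r q where "r \<in> cint x" "q \<in> Q" "y = r + int x * q" by auto
    then show ?thesis using S by (intro image_eqI[of _ _ "(- r, - q)"]) auto
  qed
  moreover have "- y \<in> ?g ` P" if "y \<in> ?g ` P" for y
  proof -
    from that obtain p where "p \<in> P" "y = int x * p" by auto
    then show ?thesis using S by (intro image_eqI[of _ _ "- p"]) auto
  qed
  ultimately show ?thesis
    by (simp add: sym_factorization_def cardA cardB)
qed

text \<open>A projective factorization sequence is read as a mixed radix system with balanced digits;
  \<open>seq_factors\<close> collects the numbers supported on the even and on the odd digit positions. Prepending a
  digit exchanges the two roles.\<close>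

fun seq_factors :: "nat list \<Rightarrow> int set \<times> int set" where
  "seq_factors [] = ({0}, {0})"
| "seq_factors (x # xs) =
     ((\<lambda>(r, q). r + int x * q) ` (cint x \<times> snd (seq_factors xs)),
      (\<lambda>p. int x * p) ` fst (seq_factors xs))"

text \<open>Follows the recursion of \<open>seq_factors\<close> and, for odd entries, gives the
  sizes of its two sets.\<close>

fun alt_prods :: "nat list \<Rightarrow> nat \<times> nat" where
  "alt_prods [] = (1, 1)"
| "alt_prods (x # xs) = (x * snd (alt_prods xs), fst (alt_prods xs))"

text \<open>Positions start at 0, so \<open>(length xs + 1) div 2\<close> of them are even. One
  formula thus covers both shapes of a factorization sequence.\<close>

lemma alt_prods_eq:
  "alt_prods xs =
    ((\<Prod>i<(length xs + 1) div 2. xs ! (2 * i)), (\<Prod>i<length xs div 2. xs ! (2 * i + 1)))"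
proof (induction xs)
  case (Cons x xs)
  have "(length (x # xs) + 1) div 2 = Suc (length xs div 2)" by simp
  then show ?case by (simp only: alt_prods.simps Cons.IH prod.lessThan_Suc_shift) simp
qed simp

lemma odd_alt_prodsD:
  assumes "odd (fst (alt_prods xs))" "odd (snd (alt_prods xs))" "x \<in> set xs"
  shows "odd x"
  using assms by (induction xs) auto

lemma odd_alt_prodsI:
  assumes "\<forall>x\<in>set xs. odd x"
  shows "odd (fst (alt_prods xs)) \<and> odd (snd (alt_prods xs))"
  using assms by (induction xs) auto

lemma proj_factorization_seqsD:
  assumes "xs \<in> proj_factorization_seqs m n" "odd m" "odd n"
  shows "alt_prods xs = (m, n)" "\<forall>x\<in>set xs. odd x \<and> x > 1" "xs \<noteq> []"
proof -
  show 1: "alt_prods xs = (m, n)"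
    using assms(1) by (auto simp: proj_factorization_seqs_def alt_prods_eq)
  show "\<forall>x\<in>set xs. odd x \<and> x > 1"
    using 1 assms(2,3) odd_alt_prodsD[of xs] assms(1)
    by (simp add: proj_factorization_seqs_def)
  show "xs \<noteq> []" using assms(1) by (auto simp: proj_factorization_seqs_def)
qed

lemma sym_factorization_seq_factors:
  assumes "\<forall>x\<in>set xs. odd x"
  shows "sym_factorization (fst (alt_prods xs)) (snd (alt_prods xs))
    (fst (seq_factors xs)) (snd (seq_factors xs))"
  using assms
proof (induction xs)
  case Nil
  show ?case by (simp add: sym_factorization_def cint_def bij_betw_def)
next
  case (Cons x xs)
  then show ?case using odd_alt_prodsI[of xs]
    by (auto intro: sym_factorization_extend)
qed

section \<open>Recovering a factorization sequence from its pair of sets\<close>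

text \<open>The second set is \<open>{0}\<close> or consists of multiples of the leading entry. This
  helps to recover that entry, and later tells the sequences for \<open>(m, n)\<close> from the
  swapped ones for \<open>(n, m)\<close>.\<close>

lemma one_notin_snd_seq_factors:
  assumes "\<forall>x\<in>set xs. x > 1"
  shows "1 \<notin> snd (seq_factors xs)"
proof (cases xs)
  case (Cons x ys)
  have "\<not> int x dvd 1" using assms Cons by auto
  then show ?thesis using Cons by (auto simp: dvd_def)
qed simp

lemma cint_subset_fst_seq_factors:
  assumes "\<forall>x\<in>set (x # xs). odd x"
  shows "cint x \<subseteq> fst (seq_factors (x # xs))"
proof
  fix r assume "r \<in> cint x"
  moreover have "0 \<in> snd (seq_factors xs)"
    using sym_factorization_seq_factors[of xs] assms by (simp add: sym_factorization_def)
  ultimately show "r \<in> fst (seq_factors (x # xs))"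
    by (auto intro: image_eqI[of _ _ "(r, 0)"])
qed

text \<open>So \<open>x\<close> can be recovered as the largest number with \<open>cint x\<close> contained in the first set.\<close>

lemma next_notin_fst_seq_factors:
  assumes odd: "odd x" and gt: "\<forall>x\<in>set xs. x > 1"
  shows "int (x div 2) + 1 \<notin> fst (seq_factors (x # xs))"
proof
  assume "int (x div 2) + 1 \<in> fst (seq_factors (x # xs))"
  then obtain r q where rq: "r \<in> cint x" "q \<in> snd (seq_factors xs)"
    "int (x div 2) + 1 = r + int x * q" by auto
  from odd obtain u where u: "x = 2 * u + 1" by (elim oddE)
  have "- int u \<le> r" "r \<le> int u" using rq(1) by (auto simp: cint_def u)
  \<comment> \<open>Here \<open>x * q = u + 1 - r\<close> lies between 1 and
    \<open>2 * u + 1\<close>, which leaves only \<open>q = 1\<close>.\<close>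
  with rq(3) have *: "0 < int x * q" "int x * q < int x * 2" by (auto simp: u)
  have "0 < int x" by (simp add: u)
  with * have "0 < q" "q < 2" by (simp_all only: zero_less_mult_iff mult_less_cancel_left_pos) auto
  then have "q = 1" by simp
  with rq(2) one_notin_snd_seq_factors[OF gt] show False by simp
qed

text \<open>If \<open>x < y\<close>, then oddness gives \<open>x div 2 + 1 <= y div 2\<close>, so
  the first gap above \<open>cint x\<close> would be filled by \<open>cint y\<close>. Applied in
  both directions, this identifies the leading entries.\<close>

lemma fst_seq_factors_le:
  assumes "\<forall>x\<in>set (x # xs). odd x \<and> x > 1" "\<forall>y\<in>set (y # ys). odd y \<and> y > 1"
    and eq: "fst (seq_factors (x # xs)) = fst (seq_factors (y # ys))"
  shows "y \<le> x"
proof (rule ccontr)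
  assume "\<not> y \<le> x"
  moreover have "odd x" "odd y" using assms(1,2) by simp_all
  ultimately have "x div 2 + 1 \<le> y div 2" by presburger
  then have "int (x div 2) + 1 \<in> cint y" by (simp add: cint_def)
  then have "int (x div 2) + 1 \<in> fst (seq_factors (y # ys))"
    using assms cint_subset_fst_seq_factors[of y ys] by fastforce
  with next_notin_fst_seq_factors[of x xs] assms eq show False by simp
qed

text \<open>A multiple of \<open>x\<close> has low digit 0, because low digits are smaller than
  \<open>x\<close> in absolute value. Hence the multiples of \<open>x\<close> in the first set
  determine the second set of the tail.\<close>

lemma mult_in_fst_seq_factors_iff:
  assumes "odd x"
  shows "int x * q \<in> fst (seq_factors (x # xs)) \<longleftrightarrow> q \<in> snd (seq_factors xs)"
proof
  assume "int x * q \<in> fst (seq_factors (x # xs))"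
  then obtain r q' where rq: "r \<in> cint x" "q' \<in> snd (seq_factors xs)" "int x * q = r + int x * q'"
    by auto
  have "r = int x * (q - q')" using rq(3) by (simp add: algebra_simps)
  then have "int x dvd r" by simp
  moreover have "\<bar>r\<bar> < int x" using rq(1) assms by (auto simp: cint_def elim!: oddE)
  ultimately have "r = 0" using dvd_imp_le_int[of r "int x"] by fastforce
  with rq assms show "q \<in> snd (seq_factors xs)" by (cases x) auto
next
  assume "q \<in> snd (seq_factors xs)"
  then show "int x * q \<in> fst (seq_factors (x # xs))" by (auto intro: image_eqI[of _ _ "(0, q)"])
qed

lemma one_in_fst_seq_factors:
  assumes "\<forall>x\<in>set xs. odd x \<and> x > 1" "xs \<noteq> []"
  shows "1 \<in> fst (seq_factors xs)"
proof (cases xs)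
  case (Cons x ys)
  have "1 \<in> cint x" using assms Cons by (auto simp: cint_def elim!: oddE)
  then show ?thesis using cint_subset_fst_seq_factors[of x ys] assms Cons by auto
qed (use assms in simp)

text \<open>Decoding goes entry by entry. The first set contains 1 only for a nonempty list; it
  determines the leading entry \<open>x\<close>, and its multiples of \<open>x\<close> determine the
  second set of the tail. Dividing the second set by \<open>x\<close> gives the first set of the
  tail.\<close>

lemma seq_factors_inject:
  assumes "\<forall>x\<in>set xs. odd x \<and> x > 1" "\<forall>y\<in>set ys. odd y \<and> y > 1"
    and "seq_factors xs = seq_factors ys"
  shows "xs = ys"
  using assms
proof (induction xs arbitrary: ys)
  case Nil
  have "1 \<notin> fst (seq_factors ys)" by (simp flip: Nil.prems(3))
  then show ?case using one_in_fst_seq_factors[of ys] Nil.prems(2) by blast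
next
  case (Cons x xs)
  then obtain y zs where ys: "ys = y # zs"
    using one_in_fst_seq_factors[of "x # xs"] by (cases ys) auto
  have xy: "y = x"
    using fst_seq_factors_le[of x xs y zs] fst_seq_factors_le[of y zs x xs] Cons.prems ys
    by (metis le_antisym)
  have oddx: "odd x" and x0: "x \<noteq> 0" using Cons.prems by auto
  have "snd (seq_factors xs) = snd (seq_factors zs)"
  proof (rule set_eqI)
    fix q
    have "fst (seq_factors (x # xs)) = fst (seq_factors (x # zs))"
      using Cons.prems(3) ys xy by simp
    then show "q \<in> snd (seq_factors xs) \<longleftrightarrow> q \<in> snd (seq_factors zs)"
      by (simp only: mult_in_fst_seq_factors_iff[OF oddx, symmetric])
  qed
  moreover have "fst (seq_factors xs) = fst (seq_factors zs)"
  proof -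
    have "(\<lambda>p. int x * p) ` fst (seq_factors xs) = (\<lambda>p. int x * p) ` fst (seq_factors zs)"
      using Cons.prems(3) ys xy by simp
    moreover have "inj (\<lambda>p. int x * p)" using x0 by (auto simp: inj_def)
    ultimately show ?thesis by (simp add: inj_image_eq_iff)
  qed
  ultimately have "seq_factors xs = seq_factors zs" by (simp add: prod_eq_iff)
  with Cons ys xy show ?case by auto
qed

section \<open>The number of decompositions\<close>

lemma sym_factorization_subset:
  assumes "sym_factorization m n A B"
  shows "A \<subseteq> cint (m * n)" "B \<subseteq> cint (m * n)"
proof -
  note S = assms[unfolded sym_factorization_def]
  have *: "a + b \<in> cint (m * n)" if "a \<in> A" "b \<in> B" for a b
    using bij_betwE[of "\<lambda>(a, b). a + b" "A \<times> B"] S that by auto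
  show "A \<subseteq> cint (m * n)" using *[of _ 0] S by auto
  show "B \<subseteq> cint (m * n)" using *[of 0] S by auto
qed

lemma finite_sym_factorizations: "finite {(A, B). sym_factorization m n A B}"
  by (rule finite_subset[of _ "Pow (cint (m * n)) \<times> Pow (cint (m * n))"])
    (use sym_factorization_subset in blast, simp)

lemma card_sym_factorizations_ge:
  assumes "odd m" "odd n"
  shows "tau m n + tau n m \<le> card {(A, B). sym_factorization m n A B}"
proof -
  let ?X = "seq_factors ` proj_factorization_seqs m n"
  let ?Y = "(prod.swap \<circ> seq_factors) ` proj_factorization_seqs n m"
  have inj: "inj_on seq_factors (proj_factorization_seqs k l)" if "odd k" "odd l" for k l
    by (rule inj_onI) (metis seq_factors_inject proj_factorization_seqsD(2) that)
  have X: "card ?X = tau m n" using inj assms by (simp add: card_image tau_def)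
  have "inj_on (prod.swap \<circ> seq_factors) (proj_factorization_seqs n m)"
    using inj assms by (intro comp_inj_on) auto
  then have Y: "card ?Y = tau n m" by (simp only: card_image tau_def)
  have XS: "?X \<subseteq> {(A, B). sym_factorization m n A B}"
  proof clarify
    fix xs A B assume "xs \<in> proj_factorization_seqs m n" "(A, B) = seq_factors xs"
    from this(1) this(2)[symmetric] show "sym_factorization m n A B"
      using proj_factorization_seqsD[of xs m n] assms sym_factorization_seq_factors[of xs] by simp
  qed
  have YS: "?Y \<subseteq> {(A, B). sym_factorization m n A B}"
  proof clarify
    fix xs A B assume "xs \<in> proj_factorization_seqs n m" "(A, B) = (prod.swap \<circ> seq_factors) xs"
    from this(1) this(2)[symmetric] show "sym_factorization m n A B"
      using proj_factorization_seqsD[of xs n m] assms sym_factorization_seq_factors[of xs]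
      by (cases "seq_factors xs") (auto intro: sym_factorization_commute)
  qed
  \<comment> \<open>The number 1 lies in the first set of a pair from \<open>?X\<close>, but not in
    the first set of a swapped pair from \<open>?Y\<close>.\<close>
  have disj: "?X \<inter> ?Y = {}"
  proof (rule equals0I)
    fix z assume "z \<in> ?X \<inter> ?Y"
    then obtain xs ys where *: "z = seq_factors xs" "z = prod.swap (seq_factors ys)"
      "xs \<in> proj_factorization_seqs m n" "ys \<in> proj_factorization_seqs n m" unfolding o_def by blast
    have "1 \<in> fst z" using *(1,3) one_in_fst_seq_factors proj_factorization_seqsD assms by metis
    moreover have "1 \<notin> fst z" using *(2,4) one_notin_snd_seq_factors[of ys]
      proj_factorization_seqsD(2)[OF *(4)] assms by simp
    ultimately show False by simp
  qed
  have "tau m n + tau n m = card (?X \<union> ?Y)"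
    using X Y disj finite_subset[OF XS finite_sym_factorizations]
      finite_subset[OF YS finite_sym_factorizations] by (simp only: card_Un_disjoint)
  also have "\<dots> \<le> card {(A, B). sym_factorization m n A B}"
    using XS YS by (intro card_mono finite_sym_factorizations) auto
  finally show ?thesis .
qed

section \<open>Odd enumerations of symmetric sets\<close>

text \<open>The value 0 off \<open>cint m\<close> makes such a function determined by its values on
  the interval, so that counting functions counts enumerations.\<close>

definition odd_enums :: "nat \<Rightarrow> int set \<Rightarrow> (int \<Rightarrow> int) set" where
  "odd_enums m A =
     {a. (\<forall>i. a (- i) = - a i) \<and> (\<forall>i. i \<notin> cint m \<longrightarrow> a i = 0) \<and> bij_betw a (cint m) A}"

text \<open>Coordinates for odd enumerations: \<open>h\<close> is a fixed bijection between the
  positive halves, \<open>p\<close> permutes the positive positions, and \<open>s\<close> collects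
  those whose sign is flipped.\<close>

definition signed_enum ::
  "nat \<Rightarrow> (int \<Rightarrow> int) \<Rightarrow> (int \<Rightarrow> int) \<Rightarrow> int set \<Rightarrow> int \<Rightarrow> int" where
  "signed_enum m h p s i =
     (if i \<in> cint m then sgn i * (if \<bar>i\<bar> \<in> s then - 1 else 1) * h (p \<bar>i\<bar>) else 0)"

definition pos_part :: "int set \<Rightarrow> int set" where
  "pos_part A = {x \<in> A. 0 < x}"

lemma signed_enum_minus: "signed_enum m h p s (- i) = - signed_enum m h p s i"
  by (simp add: signed_enum_def)

lemma abs_in_pos_part_cint: "i \<in> cint m \<Longrightarrow> i \<noteq> 0 \<Longrightarrow> \<bar>i\<bar> \<in> pos_part (cint m)"
  by (auto simp: pos_part_def cint_def)

lemma abs_signed_enum: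
  assumes h: "bij_betw h (pos_part (cint m)) (pos_part A)" and p: "p permutes pos_part (cint m)"
    and i: "i \<in> cint m" "i \<noteq> 0"
  shows "\<bar>signed_enum m h p s i\<bar> = h (p \<bar>i\<bar>)" "0 < h (p \<bar>i\<bar>)" "h (p \<bar>i\<bar>) \<in> A"
proof -
  have "p \<bar>i\<bar> \<in> pos_part (cint m)"
    using abs_in_pos_part_cint[OF i] p by (simp add: permutes_in_image)
  then have "h (p \<bar>i\<bar>) \<in> pos_part A" using h by (rule bij_betwE[rule_format, rotated])
  then show 1: "0 < h (p \<bar>i\<bar>)" "h (p \<bar>i\<bar>) \<in> A" by (auto simp: pos_part_def)
  show "\<bar>signed_enum m h p s i\<bar> = h (p \<bar>i\<bar>)"
    using i 1 by (auto simp: signed_enum_def abs_mult)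
qed

lemma signed_enum_in_odd_enums:
  assumes h: "bij_betw h (pos_part (cint m)) (pos_part A)" and p: "p permutes pos_part (cint m)"
    and A: "0 \<in> A" "\<forall>x\<in>A. - x \<in> A"
  shows "signed_enum m h p s \<in> odd_enums m A"
proof -
  let ?a = "signed_enum m h p s"
  note abs = abs_signed_enum[OF h p]
  have hp: "bij_betw (h \<circ> p) (pos_part (cint m)) (pos_part A)"
    using permutes_imp_bij[OF p] h by (rule bij_betw_trans)
  have zero: "?a i = 0 \<longleftrightarrow> i = 0" if "i \<in> cint m" for i
  proof (cases "i = 0")
    case False
    then have "\<bar>?a i\<bar> > 0" using abs(1)[of i s] abs(2)[of i] that by simp
    with False show ?thesis by simp
  qed (simp add: signed_enum_def)
  have inj: "inj_on ?a (cint m)"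
  proof (rule inj_onI)
    fix i j assume ij: "i \<in> cint m" "j \<in> cint m" and eq: "?a i = ?a j"
    show "i = j"
    proof (cases "i = 0")
      case True
      then show ?thesis using zero[OF ij(1)] zero[OF ij(2)] eq by simp
    next
      case False
      then have j0: "j \<noteq> 0" using zero[OF ij(1)] zero[OF ij(2)] eq by simp
      have "(h \<circ> p) \<bar>i\<bar> = (h \<circ> p) \<bar>j\<bar>"
        using abs(1)[of i s] abs(1)[of j s] ij False j0 eq by simp
      then have "\<bar>i\<bar> = \<bar>j\<bar>"
        by (rule inj_onD[OF bij_betw_imp_inj_on[OF hp]])
          (use ij False j0 abs_in_pos_part_cint in auto)
      \<comment> \<open>If \<open>i = - j\<close>, oddness would make the common value 0, which
        occurs only at 0.\<close>
      moreover have "i \<noteq> - j"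
        using eq signed_enum_minus[of m h p s j] zero[OF ij(2)] j0 by auto
      ultimately show ?thesis by linarith
    qed
  qed
  have "?a ` cint m = A"
  proof (rule set_eqI, rule iffI)
    fix x assume "x \<in> ?a ` cint m"
    then obtain i where i: "i \<in> cint m" "x = ?a i" by auto
    show "x \<in> A"
    proof (cases "i = 0")
      case True
      then show ?thesis using i zero[OF i(1)] A by simp
    next
      case False
      then have "\<bar>x\<bar> \<in> A" using abs[of i] i by simp
      then show ?thesis using A(2) by (cases "x < 0") (auto simp: abs_if split: if_splits)
    qed
  next
    fix x assume x: "x \<in> A"
    show "x \<in> ?a ` cint m"
    proof (cases "x = 0")
      case True
      then show ?thesis using zero[of 0] by (intro image_eqI[of _ _ 0]) simp_all
    next
      case False
      then have "\<bar>x\<bar> \<in> pos_part A" using x A(2) by (auto simp: pos_part_def abs_if)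
      then obtain k where k: "k \<in> pos_part (cint m)" "h (p k) = \<bar>x\<bar>"
        using bij_betw_imp_surj_on[OF hp] by force
      then have k': "k \<in> cint m" "0 < k" by (auto simp: pos_part_def)
      then have "\<bar>?a k\<bar> = \<bar>x\<bar>" using abs(1)[of k] k by simp
      then have "x = ?a k \<or> x = ?a (- k)" by (auto simp: signed_enum_minus abs_eq_iff)
      then show ?thesis using k' by auto
    qed
  qed
  with inj show ?thesis
    by (auto simp: odd_enums_def bij_betw_def signed_enum_minus) (simp add: signed_enum_def)
qed

text \<open>At a positive \<open>k\<close> the absolute value reveals \<open>p k\<close>, and the
  sign reveals whether \<open>k\<close> lies in \<open>s\<close>.\<close>

lemma signed_enum_inject:
  assumes h: "bij_betw h (pos_part (cint m)) (pos_part A)"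
    and p: "p permutes pos_part (cint m)" "s \<subseteq> pos_part (cint m)"
    and q: "q permutes pos_part (cint m)" "t \<subseteq> pos_part (cint m)"
    and eq: "signed_enum m h p s = signed_enum m h q t"
  shows "p = q \<and> s = t"
proof -
  have *: "p k = q k \<and> (k \<in> s \<longleftrightarrow> k \<in> t)" if k: "k \<in> pos_part (cint m)" for k
  proof -
    have k': "k \<in> cint m" "0 < k" using k by (auto simp: pos_part_def)
    note P = abs_signed_enum[OF h p(1), of k] and Q = abs_signed_enum[OF h q(1), of k]
    have hpq: "h (p k) = h (q k)" using P(1)[of s] Q(1)[of t] k' eq by simp
    moreover have "p k = q k"
      by (rule inj_onD[OF bij_betw_imp_inj_on[OF h] hpq])
        (use p q k in \<open>simp_all add: permutes_in_image\<close>)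
    moreover have "k \<in> s \<longleftrightarrow> k \<in> t"
      using fun_cong[OF eq, of k] P(2) Q(2) k' by (auto simp: signed_enum_def split: if_splits)
    ultimately show ?thesis by simp
  qed
  have "p k = q k" for k
    using *[of k] permutes_not_in[OF p(1)] permutes_not_in[OF q(1)] by (cases "k \<in> pos_part (cint m)") auto
  then show ?thesis using * p(2) q(2) by blast
qed

lemma finite_pos_part [simp]: "finite A \<Longrightarrow> finite (pos_part A)"
  by (simp add: pos_part_def)

lemma card_pos_part_cint [simp]: "card (pos_part (cint m)) = m div 2"
proof -
  have "pos_part (cint m) = {1..int (m div 2)}" by (auto simp: pos_part_def cint_def)
  then show ?thesis by simp
qed

text \<open>The power of 2 counts the sets \<open>s\<close> of flipped signs. Leaving
  \<open>G\<close> and \<open>X\<close> open covers both the family of all permutations and the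
  parity-preserving ones.\<close>

lemma card_signed_enums_ge:
  assumes h: "bij_betw h (pos_part (cint m)) (pos_part A)"
    and G: "G \<subseteq> {p. p permutes pos_part (cint m)}"
    and X: "finite X" "\<And>p s. p \<in> G \<Longrightarrow> signed_enum m h p s \<in> X"
  shows "2 ^ (m div 2) * card G \<le> card X"
proof -
  let ?f = "\<lambda>(p, s). signed_enum m h p s"
  let ?D = "G \<times> Pow (pos_part (cint m))"
  have "inj_on ?f ?D"
  proof (rule inj_onI, clarify)
    fix p s q t
    assume "p \<in> G" "q \<in> G" "s \<subseteq> pos_part (cint m)" "t \<subseteq> pos_part (cint m)"
      "signed_enum m h p s = signed_enum m h q t"
    then show "p = q \<and> s = t" using signed_enum_inject[OF h, of p s q t] G by auto
  qed
  then have "card ?D \<le> card X"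
    using X by (intro card_inj_on_le[of ?f]) auto
  then show ?thesis by (simp add: card_cartesian_product card_Pow mult.commute)
qed

lemma finite_odd_enums:
  assumes "finite A"
  shows "finite (odd_enums m A)"
  by (rule finite_subset[OF _ finite_set_of_finite_funs[OF finite_cint[of m] assms, of 0]])
    (auto simp: odd_enums_def bij_betw_def)

section \<open>Symmetric sets and the parities of their elements\<close>

lemma sum_sym_set:
  fixes f :: "int \<Rightarrow> int"
  assumes "finite A" "0 \<in> A" "\<forall>x\<in>A. - x \<in> A" "\<And>x. f (- x) = f x"
  shows "sum f A = f 0 + 2 * sum f (pos_part A)"
proof -
  have A: "A = insert 0 (pos_part A \<union> uminus ` pos_part A)"
    using assms(2,3) by (auto simp: pos_part_def image_iff) (metis minus_minus neg_0_less_iff_less not_less_iff_gr_or_eq)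
  have "sum f A = f 0 + sum f (pos_part A \<union> uminus ` pos_part A)"
    using assms(1) by (subst A, subst sum.insert) (auto simp: pos_part_def)
  also have "sum f (pos_part A \<union> uminus ` pos_part A) = sum f (pos_part A) + sum f (uminus ` pos_part A)"
    using assms(1) by (intro sum.union_disjoint) (auto simp: pos_part_def)
  also have "sum f (uminus ` pos_part A) = sum f (pos_part A)"
    using assms(4) by (simp add: sum.reindex)
  finally show ?thesis by simp
qed

lemma card_pos_part:
  assumes "finite A" "0 \<in> A" "\<forall>x\<in>A. - x \<in> A"
  shows "card (pos_part A) = card A div 2"
  using sum_sym_set[OF assms, of "\<lambda>_. 1"] by simp

text \<open>This character sum is multiplicative over direct sums, so it is \<open>\<plusminus>1\<close> on both summands of an
  interval. That forces each summand to have as many odd elements as an interval of the same size.\<close>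

definition parity_sum :: "int set \<Rightarrow> int" where
  "parity_sum A = (\<Sum>x\<in>A. if even x then 1 else - 1)"

text \<open>Passing from \<open>u\<close> to \<open>Suc u\<close> adds two endpoints of equal
  parity, and \<open>(- 1) ^ u + 2 * (- 1) ^ Suc u = (- 1) ^ Suc u\<close>.\<close>

lemma parity_sum_interval: "parity_sum {- int u..int u} = (- 1) ^ u"
proof (induction u)
  case (Suc u)
  have "{- int (Suc u)..int (Suc u)} = insert (int (Suc u)) (insert (- int (Suc u)) {- int u..int u})"
    by auto
  then show ?case using Suc by (simp add: parity_sum_def)
qed (simp add: parity_sum_def)

lemma abs_parity_sum_sym_factorization:
  assumes "sym_factorization m n A B"
  shows "\<bar>parity_sum A\<bar> = 1"
proof -
  let ?e = "\<lambda>x::int. if even x then 1 else - 1 :: int"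
  have bij: "bij_betw (\<lambda>(a, b). a + b) (A \<times> B) (cint (m * n))"
    using assms by (simp add: sym_factorization_def)
  have "parity_sum A * parity_sum B = (\<Sum>(a, b)\<in>A \<times> B. ?e a * ?e b)"
    by (simp add: parity_sum_def sum_product sum.cartesian_product)
  also have "\<dots> = (\<Sum>z\<in>A \<times> B. ?e ((\<lambda>(a, b). a + b) z))"
    by (rule sum.cong) auto
  also have "\<dots> = parity_sum (cint (m * n))"
    using sum.reindex_bij_betw[OF bij, of ?e] by (simp add: parity_sum_def)
  finally have "\<bar>parity_sum A * parity_sum B\<bar> = 1"
    by (simp add: cint_def parity_sum_interval power_abs)
  then show ?thesis using zmult_eq_1_iff[of "\<bar>parity_sum A\<bar>"] by (auto simp: abs_mult)
qed

text \<open>If \<open>e\<close> and \<open>f\<close> count the even and the odd positive elements,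
  pairing \<open>x\<close> with \<open>- x\<close> gives parity sum \<open>1 + 2 * (e - f)\<close>.
  So \<open>e - f\<close> is 0 or -1, and the parity of \<open>e + f = card A div 2\<close> decides
  which.\<close>

lemma card_even_odd_pos_part:
  assumes A: "finite A" "0 \<in> A" "\<forall>x\<in>A. - x \<in> A" and ps: "\<bar>parity_sum A\<bar> = 1"
  shows "card {x \<in> pos_part A. even x} = card A div 2 div 2"
    "card {x \<in> pos_part A. odd x} = (card A div 2 + 1) div 2"
proof -
  let ?E = "{x \<in> pos_part A. even x}" and ?O = "{x \<in> pos_part A. odd x}"
  have PA: "pos_part A = ?E \<union> ?O" by auto
  have fin: "finite ?E" "finite ?O" using A(1) by simp_all
  have "card ?E + card ?O = card (?E \<union> ?O)" using fin by (subst card_Un_disjoint) auto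
  then have 1: "card ?E + card ?O = card A div 2" using card_pos_part[OF A] PA by simp
  have "(\<Sum>x\<in>?E \<union> ?O. if even x then 1 else - 1) = int (card ?E) - int (card ?O)"
    using fin by (subst sum.union_disjoint) auto
  then have "(\<Sum>x\<in>pos_part A. if even x then 1 else - 1) = int (card ?E) - int (card ?O)"
    using PA by simp
  with sum_sym_set[OF A, of "\<lambda>x. if even x then 1 else - 1"]
  have "parity_sum A = 1 + 2 * (int (card ?E) - int (card ?O))"
    by (simp add: parity_sum_def)
  with ps have "int (card ?E) - int (card ?O) = 0 \<or> int (card ?E) - int (card ?O) = - 1"
    by presburger
  moreover have "e = c div 2 \<and> f = (c + 1) div 2"
    if "e + f = c" "int e - int f = 0 \<or> int e - int f = - 1" for e f c :: nat
    using that by presburger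
  ultimately show "card ?E = card A div 2 div 2" "card ?O = (card A div 2 + 1) div 2"
    using 1 by blast+
qed

text \<open>Of the numbers from 1 to \<open>m div 2\<close>, exactly \<open>m div 2 div 2\<close>
  are even and \<open>(m div 2 + 1) div 2\<close> are odd. So \<open>beta m\<close> is the number of
  their parity-preserving permutations.\<close>

lemma beta_eq:
  assumes "odd m"
  shows "beta m = fact (m div 2 div 2) * fact ((m div 2 + 1) div 2)"
proof -
  define k where "k = m div 4"
  have "m mod 4 = 1 \<or> m mod 4 = 3" using assms by presburger
  then consider "m = 4 * k + 1" | "m = 4 * k + 3"
    using div_mult_mod_eq[of m 4] unfolding k_def by (metis mult.commute)
  then show ?thesis
  proof cases
    case 1
    then have "m mod 4 = 1" "m - 1 = 4 * k" "m div 2 = 2 * k" by simp_all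
    then show ?thesis by (simp add: beta_def power2_eq_square)
  next
    case 2
    then have "m mod 4 = 3" "m - 3 = 4 * k" "m + 1 = 4 * (k + 1)" "m div 2 = 2 * k + 1" by simp_all
    then show ?thesis by (simp add: beta_def)
  qed
qed

definition parity_enums :: "nat \<Rightarrow> int set \<Rightarrow> (int \<Rightarrow> int) set" where
  "parity_enums m A = {a \<in> odd_enums m A. \<forall>i\<in>cint m. even (a i) \<longleftrightarrow> even i}"

lemma card_odd_enums_ge:
  assumes A: "finite A" "0 \<in> A" "\<forall>x\<in>A. - x \<in> A" "card A = m"
  shows "2 ^ (m div 2) * fact (m div 2) \<le> card (odd_enums m A)"
proof -
  obtain h where h: "bij_betw h (pos_part (cint m)) (pos_part A)"
    using finite_same_card_bij[of "pos_part (cint m)" "pos_part A"] card_pos_part[OF A(1-3)] A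
    by auto
  have "2 ^ (m div 2) * card {p. p permutes pos_part (cint m)} \<le> card (odd_enums m A)"
    using signed_enum_in_odd_enums[OF h _ A(2,3)] finite_odd_enums[OF A(1)]
    by (intro card_signed_enums_ge[OF h]) simp_all
  then show ?thesis by (simp add: card_permutations)
qed

lemma card_parity_enums_ge:
  assumes A: "finite A" "0 \<in> A" "\<forall>x\<in>A. - x \<in> A" "card A = m" and ps: "\<bar>parity_sum A\<bar> = 1"
    and "odd m"
  shows "2 ^ (m div 2) * beta m \<le> card (parity_enums m A)"
proof -
  let ?I = "pos_part (cint m)"
  let ?E = "{x \<in> ?I. even x}" and ?O = "{x \<in> ?I. odd x}"
  have "\<bar>parity_sum (cint m)\<bar> = 1" by (simp add: cint_def parity_sum_interval power_abs)
  \<comment> \<open>\<open>cint m\<close> and \<open>A\<close> have equally many positive even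
    elements, and equally many positive odd ones, so \<open>h\<close> below can be chosen to
    preserve parity.\<close>
  note cI = card_even_odd_pos_part[of "cint m", OF _ _ _ this, simplified]
  note cA = card_even_odd_pos_part[OF A(1-3) ps]
  obtain h1 where h1: "bij_betw h1 ?E {x \<in> pos_part A. even x}"
    using finite_same_card_bij[of ?E "{x \<in> pos_part A. even x}"] cI cA A card_cint[OF \<open>odd m\<close>] by auto
  obtain h2 where h2: "bij_betw h2 ?O {x \<in> pos_part A. odd x}"
    using finite_same_card_bij[of ?O "{x \<in> pos_part A. odd x}"] cI cA A card_cint[OF \<open>odd m\<close>] by auto
  define h where "h x = (if x \<in> ?E then h1 x else h2 x)" for x
  have "bij_betw h (?E \<union> ?O) ({x \<in> pos_part A. even x} \<union> {x \<in> pos_part A. odd x})"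
    unfolding h_def by (intro bij_betw_disjoint_Un h1 h2) auto
  moreover have "?E \<union> ?O = ?I" "{x \<in> pos_part A. even x} \<union> {x \<in> pos_part A. odd x} = pos_part A" by auto
  ultimately have h: "bij_betw h ?I (pos_part A)" by simp
  have hpar: "even (h k) \<longleftrightarrow> even k" if "k \<in> ?I" for k
  proof (cases "even k")
    case True
    then have "h k \<in> {x \<in> pos_part A. even x}" using bij_betwE[OF h1] that by (simp add: h_def)
    with True show ?thesis by simp
  next
    case False
    then have "h k \<in> {x \<in> pos_part A. odd x}" using bij_betwE[OF h2] that by (simp add: h_def)
    with False show ?thesis by simp
  qed
  \<comment> \<open>Parity-preserving permutations are built as products of two permutations with
    disjoint supports; the product determines both factors.\<close>
  let ?P = "{p. p permutes ?E} \<times> {p. p permutes ?O}"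
  let ?c = "\<lambda>(p, q). p \<circ> q"
  have inj: "inj_on ?c ?P"
  proof (rule inj_onI, clarify)
    fix p q p' q'
    assume P: "p permutes ?E" "q permutes ?O" "p' permutes ?E" "q' permutes ?O"
      and eq: "p \<circ> q = p' \<circ> q'"
    have pq: "p k = p' k \<and> q k = q' k" for k
    proof (cases "k \<in> ?O")
      case True
      then have "q k \<in> ?O" "q' k \<in> ?O" using permutes_in_image[OF P(2)] permutes_in_image[OF P(4)] by simp_all
      then have "p (q k) = q k" "p' (q' k) = q' k"
        using permutes_not_in[OF P(1)] permutes_not_in[OF P(3)] by simp_all
      moreover have "p k = k" "p' k = k"
        using True permutes_not_in[OF P(1)] permutes_not_in[OF P(3)] by simp_all
      ultimately show ?thesis using fun_cong[OF eq, of k] by simp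
    next
      case False
      then have "q k = k" "q' k = k" using permutes_not_in[OF P(2)] permutes_not_in[OF P(4)] by blast+
      then show ?thesis using fun_cong[OF eq, of k] by simp
    qed
    then show "p = p' \<and> q = q'" by auto
  qed
  have G: "p \<circ> q permutes ?I \<and> (\<forall>k\<in>?I. even ((p \<circ> q) k) \<longleftrightarrow> even k)"
    if P: "p permutes ?E" "q permutes ?O" for p q
  proof
    have "p permutes ?I" "q permutes ?I"
      by (rule permutes_subset[OF P(1)], blast, rule permutes_subset[OF P(2)], blast)
    then show "p \<circ> q permutes ?I" by (intro permutes_compose)
    have "even (q k) \<longleftrightarrow> even k" for k
      using permutes_in_image[OF P(2), of k] permutes_not_in[OF P(2), of k] by (cases "k \<in> ?O") auto
    moreover have "even (p k) \<longleftrightarrow> even k" for k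
      using permutes_in_image[OF P(1), of k] permutes_not_in[OF P(1), of k] by (cases "k \<in> ?E") auto
    ultimately show "\<forall>k\<in>?I. even ((p \<circ> q) k) \<longleftrightarrow> even k" by simp
  qed
  have "finite (parity_enums m A)"
    using finite_odd_enums[OF A(1)] by (simp add: parity_enums_def)
  moreover have "signed_enum m h g s \<in> parity_enums m A" if "g \<in> ?c ` ?P" for g s
  proof -
    from that have g: "g permutes ?I" "\<And>k. k \<in> ?I \<Longrightarrow> even (g k) \<longleftrightarrow> even k" using G by auto
    have "even (signed_enum m h g s i) \<longleftrightarrow> even i" if i: "i \<in> cint m" for i
    proof (cases "i = 0")
      case False
      then have k: "\<bar>i\<bar> \<in> ?I" using i abs_in_pos_part_cint by simp
      have "even (h (g \<bar>i\<bar>)) \<longleftrightarrow> even i"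
        using hpar g k by (simp add: permutes_in_image)
      moreover have "odd (sgn i)" using False by (simp add: sgn_if)
      ultimately show ?thesis using i False by (simp add: signed_enum_def)
    qed (simp add: signed_enum_def)
    then show ?thesis using signed_enum_in_odd_enums[OF h g(1) A(2,3)]
      by (simp add: parity_enums_def)
  qed
  moreover have "?c ` ?P \<subseteq> {p. p permutes ?I}" using G by auto
  ultimately have "2 ^ (m div 2) * card (?c ` ?P) \<le> card (parity_enums m A)"
    by (intro card_signed_enums_ge[OF h])
  moreover have "card (?c ` ?P) = beta m"
    using cI card_cint[OF \<open>odd m\<close>]
    by (simp add: card_image[OF inj] card_cartesian_product card_permutations beta_eq[OF \<open>odd m\<close>])
  ultimately show ?thesis by simp
qed

section \<open>Pairs of odd functions and their number\<close>

definition odd_pairs :: "nat \<Rightarrow> nat \<Rightarrow> ((int \<Rightarrow> int) \<times> (int \<Rightarrow> int)) set" where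
  "odd_pairs m n =
     {(a, b). (\<forall>i. a (- i) = - a i) \<and> (\<forall>j. b (- j) = - b j) \<and>
        (\<forall>i. i \<notin> cint m \<longrightarrow> a i = 0) \<and> (\<forall>j. j \<notin> cint n \<longrightarrow> b j = 0) \<and>
        bij_betw (\<lambda>(i, j). a i + b j) (cint m \<times> cint n) (cint (m * n))}"

definition parity_pairs :: "nat \<Rightarrow> nat \<Rightarrow> ((int \<Rightarrow> int) \<times> (int \<Rightarrow> int)) set" where
  "parity_pairs m n =
     {(a, b) \<in> odd_pairs m n.
        (\<forall>i\<in>cint m. even (a i) \<longleftrightarrow> even i) \<and> (\<forall>j\<in>cint n. even (b j) \<longleftrightarrow> even j)}"

lemma odd_pairsD:
  assumes "(a, b) \<in> odd_pairs m n"
  shows "a (- i) = - a i" "b (- j) = - b j" "a 0 = 0" "b 0 = 0"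
    "i \<notin> cint m \<Longrightarrow> a i = 0" "j \<notin> cint n \<Longrightarrow> b j = 0"
    "bij_betw (\<lambda>(i, j). a i + b j) (cint m \<times> cint n) (cint (m * n))"
proof -
  have "a (- 0) = - a 0" "b (- 0) = - b 0"
    using assms unfolding odd_pairs_def by blast+
  then show "a 0 = 0" "b 0 = 0" by simp_all
qed (use assms in \<open>simp_all add: odd_pairs_def\<close>)

lemma odd_enums_imp_odd_pairs:
  assumes AB: "sym_factorization m n A B" and a: "a \<in> odd_enums m A" and b: "b \<in> odd_enums n B"
  shows "(a, b) \<in> odd_pairs m n"
proof -
  have "bij_betw (map_prod a b) (cint m \<times> cint n) (A \<times> B)"
    using a b by (intro bij_betw_map_prod) (simp_all add: odd_enums_def)
  moreover have "bij_betw (\<lambda>(a, b). a + b) (A \<times> B) (cint (m * n))"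
    using AB by (simp add: sym_factorization_def)
  ultimately have "bij_betw ((\<lambda>(a, b). a + b) \<circ> map_prod a b) (cint m \<times> cint n) (cint (m * n))"
    by (rule bij_betw_trans)
  moreover have "(\<lambda>(a, b). a + b) \<circ> map_prod a b = (\<lambda>(i, j). a i + b j)"
    by (auto simp: fun_eq_iff)
  ultimately show ?thesis using a b by (simp add: odd_pairs_def odd_enums_def)
qed

text \<open>Since \<open>a\<close> and \<open>b\<close> vanish at 0, their values on the intervals
  are the sums \<open>a i + b 0\<close> and \<open>a 0 + b j\<close>, which lie in
  \<open>cint (m * n)\<close>.\<close>

lemma finite_odd_pairs: "finite (odd_pairs m n)"
proof -
  let ?F = "\<lambda>k. {f. \<forall>x. (x \<in> cint k \<longrightarrow> f x \<in> cint (m * n)) \<and> (x \<notin> cint k \<longrightarrow> f x = 0)}"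
  have "odd_pairs m n \<subseteq> ?F m \<times> ?F n"
  proof
    fix z assume "z \<in> odd_pairs m n"
    then obtain a b where z: "z = (a, b)" and ab: "(a, b) \<in> odd_pairs m n" by (cases z) auto
    note D = odd_pairsD[OF ab]
    have "a i + b j \<in> cint (m * n)" if "i \<in> cint m" "j \<in> cint n" for i j
      using bij_betwE[OF D(7)] that by auto
    from this[of _ 0] this[of 0] show "z \<in> ?F m \<times> ?F n" using D(3-6) z by auto
  qed
  then show ?thesis
    by (rule finite_subset) (intro finite_cartesian_product finite_set_of_finite_funs finite_cint)
qed

text \<open>Different decompositions yield different pairs, since \<open>A\<close> and
  \<open>B\<close> are the images of the intervals under \<open>a\<close> and \<open>b\<close>; so
  the counts add up over all decompositions. \<open>U\<close> and \<open>V\<close> stand for all odd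
  enumerations or for the parity-preserving ones.\<close>

lemma card_enum_pairs_ge:
  assumes "odd m" "odd n" "finite X"
    and X: "\<And>A B a b. sym_factorization m n A B \<Longrightarrow> a \<in> U A \<Longrightarrow> b \<in> V B \<Longrightarrow> (a, b) \<in> X"
    and UV: "\<And>A. U A \<subseteq> odd_enums m A" "\<And>B. V B \<subseteq> odd_enums n B"
    and card: "\<And>A B. sym_factorization m n A B \<Longrightarrow> c \<le> card (U A)"
      "\<And>A B. sym_factorization m n A B \<Longrightarrow> d \<le> card (V B)"
  shows "(tau m n + tau n m) * (c * d) \<le> card X"
proof -
  let ?F = "{(A, B). sym_factorization m n A B}"
  let ?D = "SIGMA z:?F. U (fst z) \<times> V (snd z)"
  have "inj_on snd ?D"
  proof (rule inj_onI)
    fix y z assume y: "y \<in> ?D" and z: "z \<in> ?D" and eq: "snd y = snd z"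
    obtain A B a b where y': "y = ((A, B), (a, b))" by (metis prod.collapse)
    obtain A' B' where z': "z = ((A', B'), (a, b))" using eq y' by (metis prod.collapse snd_conv)
    have "a \<in> odd_enums m A" "a \<in> odd_enums m A'" "b \<in> odd_enums n B" "b \<in> odd_enums n B'"
      using y z UV unfolding y' z' by auto
    then have "A = A' \<and> B = B'" by (auto simp: odd_enums_def bij_betw_def)
    then show "y = z" by (simp add: y' z')
  qed
  moreover have "snd ` ?D \<subseteq> X" using X by auto
  ultimately have le: "card ?D \<le> card X" using \<open>finite X\<close> by (rule card_inj_on_le)
  have fin: "finite (U A)" "finite (V B)" if "sym_factorization m n A B" for A B
    using that UV sym_factorization_subset[OF that] finite_odd_enums finite_subset finite_cint
    by metis+
  have "(tau m n + tau n m) * (c * d) \<le> card ?F * (c * d)"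
    using card_sym_factorizations_ge[OF assms(1,2)] by (rule mult_right_mono) simp
  also have "\<dots> = (\<Sum>z\<in>?F. c * d)" by simp
  also have "\<dots> \<le> (\<Sum>z\<in>?F. card (U (fst z) \<times> V (snd z)))"
  proof (rule sum_mono)
    fix z assume "z \<in> ?F"
    then have "sym_factorization m n (fst z) (snd z)" by auto
    from card(1)[OF this] card(2)[OF this] show "c * d \<le> card (U (fst z) \<times> V (snd z))"
      by (simp add: card_cartesian_product mult_mono)
  qed
  also have "\<dots> = card ?D"
    using finite_sym_factorizations fin by (intro card_SigmaI[symmetric]) auto
  also note le
  finally show ?thesis .
qed

lemma sym_factorizationD:
  assumes "sym_factorization m n A B"
  shows "finite A" "0 \<in> A" "\<forall>x\<in>A. - x \<in> A" "card A = m"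
  using assms finite_subset[OF sym_factorization_subset(1)[OF assms]]
  by (auto simp: sym_factorization_def)

lemma card_odd_pairs_ge:
  assumes "odd m" "odd n"
  shows "(tau m n + tau n m) *
      ((2 ^ (m div 2) * fact (m div 2)) * (2 ^ (n div 2) * fact (n div 2))) \<le> card (odd_pairs m n)"
proof (rule card_enum_pairs_ge[OF assms finite_odd_pairs])
  fix A B assume AB: "sym_factorization m n A B"
  show "2 ^ (m div 2) * fact (m div 2) \<le> card (odd_enums m A)"
    by (rule card_odd_enums_ge[OF sym_factorizationD[OF AB]])
  show "2 ^ (n div 2) * fact (n div 2) \<le> card (odd_enums n B)"
    by (rule card_odd_enums_ge[OF sym_factorizationD[OF sym_factorization_commute[OF AB]]])
qed (auto intro: odd_enums_imp_odd_pairs)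

lemma card_parity_pairs_ge:
  assumes "odd m" "odd n"
  shows "(tau m n + tau n m) *
      ((2 ^ (m div 2) * beta m) * (2 ^ (n div 2) * beta n)) \<le> card (parity_pairs m n)"
proof (rule card_enum_pairs_ge[OF assms])
  show "finite (parity_pairs m n)"
    by (rule finite_subset[OF _ finite_odd_pairs[of m n]]) (auto simp: parity_pairs_def)
next
  fix A B assume AB: "sym_factorization m n A B"
  note BA = sym_factorization_commute[OF AB]
  show "2 ^ (m div 2) * beta m \<le> card (parity_enums m A)"
    using card_parity_enums_ge[OF sym_factorizationD[OF AB]] abs_parity_sum_sym_factorization[OF AB] assms
    by simp
  show "2 ^ (n div 2) * beta n \<le> card (parity_enums n B)"
    using card_parity_enums_ge[OF sym_factorizationD[OF BA]] abs_parity_sum_sym_factorization[OF BA] assms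
    by simp
next
  fix A B a b
  assume "sym_factorization m n A B" "a \<in> parity_enums m A" "b \<in> parity_enums n B"
  then show "(a, b) \<in> parity_pairs m n"
    by (auto simp: parity_pairs_def parity_enums_def intro: odd_enums_imp_odd_pairs)
qed (auto simp: parity_enums_def)

section \<open>Labelings\<close>

text \<open>Indices start at 1, so for odd \<open>m\<close> the middle index
  \<open>m div 2 + 1\<close> goes to 0.\<close>

definition centered :: "nat \<Rightarrow> nat \<Rightarrow> int" where
  "centered m i = int i - int (m div 2) - 1"

lemma bij_betw_centered:
  assumes "odd m"
  shows "bij_betw (centered m) {1..m} (cint m)"
proof -
  have inj: "inj_on (centered m) {1..m}" by (auto simp: inj_on_def centered_def)
  have "centered m ` {1..m} \<subseteq> cint m"
    using assms by (auto simp: centered_def cint_def elim!: oddE)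
  moreover have "card (centered m ` {1..m}) = card (cint m)"
    using card_image[OF inj] card_cint[OF assms] by simp
  ultimately have "centered m ` {1..m} = cint m"
    by (intro card_subset_eq) simp_all
  with inj show ?thesis by (simp add: bij_betw_def)
qed

lemma centered_reflect: "odd m \<Longrightarrow> i \<le> m \<Longrightarrow> centered m (m + 1 - i) = - centered m i"
  by (auto simp: centered_def of_nat_diff elim!: oddE)

lemma centered_Suc: "centered m (Suc i) = centered m i + 1" "centered m (i + 1) = centered m i + 1"
  by (simp_all add: centered_def)

definition signed_sum :: "(int \<Rightarrow> int) \<times> (int \<Rightarrow> int) \<Rightarrow> int \<times> int \<Rightarrow> int" where
  "signed_sum = (\<lambda>(a, b) (i, j). if even (i + j) then a i + b j else - (a i + b j))"

text \<open>The signs do not affect the set of values: flipping the sign of the value at a point amounts to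
  reading the unsigned sum at the antipodal point.\<close>

lemma bij_betw_signed_sum:
  assumes z: "z \<in> odd_pairs m n"
  shows "bij_betw (signed_sum z) (cint m \<times> cint n) (cint (m * n))"
proof -
  obtain a b where ab: "z = (a, b)" by (cases z)
  note D = odd_pairsD[OF z[unfolded ab]]
  define g where "g = (\<lambda>(i, j). if even (i + j) then (i, j) else (- i, - j :: int) :: int \<times> int)"
  have gg: "g (g p) = p" for p by (cases p) (simp add: g_def)
  have gS: "g ` (cint m \<times> cint n) \<subseteq> cint m \<times> cint n"
    by (auto simp: g_def split: if_splits)
  have "bij_betw g (cint m \<times> cint n) (cint m \<times> cint n)"
    by (rule bij_betw_byWitness[of _ g]) (use gg gS in blast)+
  then have "bij_betw ((\<lambda>(i, j). a i + b j) \<circ> g) (cint m \<times> cint n) (cint (m * n))"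
    using D(7) by (rule bij_betw_trans)
  moreover have "(\<lambda>(i, j). a i + b j) \<circ> g = signed_sum z"
    using D(1,2) by (auto simp: fun_eq_iff g_def signed_sum_def ab)
  ultimately show ?thesis by simp
qed

definition vertex_value :: "nat \<Rightarrow> nat \<Rightarrow> (int \<Rightarrow> int) \<times> (int \<Rightarrow> int) \<Rightarrow> nat \<times> nat \<Rightarrow> int" where
  "vertex_value m n z = (\<lambda>(i, j). signed_sum z (centered m i, centered n j))"

text \<open>\<open>\<phi>\<close> turns centred values into labels. Keeping it as a parameter lets
  three families of labelings share their proofs.\<close>

definition labeling ::
  "nat \<Rightarrow> nat \<Rightarrow> (int \<Rightarrow> int) \<Rightarrow> (int \<Rightarrow> int) \<times> (int \<Rightarrow> int) \<Rightarrow> nat \<times> nat \<Rightarrow> nat" where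
  "labeling m n \<phi> z = restrict (\<lambda>p. nat (\<phi> (vertex_value m n z p))) (proj_vertices m n)"

lemma bij_betw_vertex_value:
  assumes "odd m" "odd n" "z \<in> odd_pairs m n"
  shows "bij_betw (vertex_value m n z) (proj_vertices m n) (cint (m * n))"
proof -
  have "bij_betw (map_prod (centered m) (centered n)) (proj_vertices m n) (cint m \<times> cint n)"
    unfolding proj_vertices_def using assms by (intro bij_betw_map_prod bij_betw_centered)
  then have "bij_betw (signed_sum z \<circ> map_prod (centered m) (centered n)) (proj_vertices m n) (cint (m * n))"
    using bij_betw_signed_sum[OF assms(3)] by (rule bij_betw_trans)
  moreover have "signed_sum z \<circ> map_prod (centered m) (centered n) = vertex_value m n z"
    by (auto simp: vertex_value_def fun_eq_iff)
  ultimately show ?thesis by simp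
qed

lemma bij_betw_labeling:
  assumes "odd m" "odd n" "z \<in> odd_pairs m n" and \<phi>: "bij_betw \<phi> (cint (m * n)) {1..int (m * n)}"
  shows "bij_betw (labeling m n \<phi> z) (proj_vertices m n) {1..m * n}"
proof -
  have "bij_betw nat {1..int k} {1..k}" for k
    by (rule bij_betw_byWitness[of _ int]) auto
  then have "bij_betw (nat \<circ> (\<phi> \<circ> vertex_value m n z)) (proj_vertices m n) {1..m * n}"
    by (intro bij_betw_trans[OF bij_betw_trans[OF bij_betw_vertex_value[OF assms(1-3)] \<phi>]])
  then show ?thesis
    by (rule bij_betw_cong[THEN iffD1, rotated]) (simp add: labeling_def)
qed

section \<open>Face sums\<close>

text \<open>Each of \<open>a i\<close>, \<open>a (i + 1)\<close>, \<open>b j\<close> and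
  \<open>b (j + 1)\<close> enters twice, with opposite signs.\<close>

lemma signed_sum_square:
  "signed_sum z (i, j) + signed_sum z (i + 1, j + 1) +
   signed_sum z (i + 1, j) + signed_sum z (i, j + 1) = 0"
  by (cases z) (simp add: signed_sum_def)

lemma signed_sum_antipode:
  assumes "z \<in> odd_pairs m n"
  shows "signed_sum z (- i, - j) = - signed_sum z (i, j)"
  using odd_pairsD(1,2)[of "fst z" "snd z" m n] assms by (cases z) (simp add: signed_sum_def)

definition even_vertex :: "nat \<Rightarrow> nat \<Rightarrow> nat \<times> nat \<Rightarrow> bool" where
  "even_vertex m n = (\<lambda>(i, j). even (centered m i + centered n j))"

text \<open>The corners are listed in pairs \<open>p\<close>, \<open>q\<close> and \<open>r\<close>,
  \<open>s\<close> of equal parity: diagonal pairs on an inner face, antipodal pairs on a face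
  crossing the boundary. In the latter case the values of each pair already cancel.\<close>

lemma face_cases:
  assumes F: "F \<in> proj_C4_faces m n" and mn: "3 \<le> m" "3 \<le> n" "odd m" "odd n"
    and z: "z \<in> odd_pairs m n"
  defines "v \<equiv> vertex_value m n z"
    and "par \<equiv> even_vertex m n"
  obtains p q r s where "F = {p, q, r, s}" "distinct [p, q, r, s]" "{p, q, r, s} \<subseteq> proj_vertices m n"
    "v p + v q + v r + v s = 0" "par p \<longleftrightarrow> par q" "par r \<longleftrightarrow> par s" "par p \<longleftrightarrow> \<not> par r"
proof -
  note anti = signed_sum_antipode[OF z]
  \<comment> \<open>The reflection sends \<open>i + 1\<close> to
    \<open>k + 1 - (i + 1) = k - i\<close>.\<close>
  have refl2: "centered k (k - i) = - centered k i - 1" if "odd k" "i \<le> k - 1" "1 \<le> i" for k i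
    using centered_reflect[of k "i + 1"] that by (simp add: centered_Suc)
  have ends: "centered k k = int (k div 2)" "centered k 1 = - int (k div 2)" if "odd k" for k
    using that by (auto simp: centered_def elim!: oddE)
  consider (inner) i j where "i \<in> {1..m - 1}" "j \<in> {1..n - 1}"
      "F = {(i, j), (i + 1, j + 1), (i + 1, j), (i, j + 1)}"
  | (right) i where "i \<in> {1..m - 1}" "F = {(i, n), (m + 1 - i, 1), (i + 1, n), (m - i, 1)}"
  | (bottom) j where "j \<in> {1..n - 1}" "F = {(m, j), (1, n + 1 - j), (m, j + 1), (1, n - j)}"
  proof -
    have swap: "{p, q, r, s} = {p, s, q, r}" "{p, q, r, s} = {p, r, q, s}" for p q r s :: "nat \<times> nat"
      by auto
    from F show thesis
      unfolding proj_C4_faces_def Un_iff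
    proof (elim disjE CollectE exE conjE)
      fix i j
      assume "F = {(i, j), (i + 1, j), (i, j + 1), (i + 1, j + 1)}" "i \<in> {1..m - 1}" "j \<in> {1..n - 1}"
      then show thesis using inner swap(1) by metis
    next
      fix i assume "F = {(i, n), (i + 1, n), (m + 1 - i, 1), (m - i, 1)}" "i \<in> {1..m - 1}"
      then show thesis using right swap(2) by metis
    next
      fix j assume "F = {(m, j), (m, j + 1), (1, n + 1 - j), (1, n - j)}" "j \<in> {1..n - 1}"
      then show thesis using bottom swap(2) by metis
    qed
  qed
  then show thesis
  proof cases
    case inner
    show thesis
    proof (rule that[OF inner(3)])
      show "v (i, j) + v (i + 1, j + 1) + v (i + 1, j) + v (i, j + 1) = 0"
        unfolding v_def vertex_value_def prod.case centered_Suc by (rule signed_sum_square)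
    qed (use inner in \<open>auto simp: par_def even_vertex_def centered_Suc proj_vertices_def\<close>)
  next
    case right
    have c: "centered m (m + 1 - i) = - centered m i" "centered m (m - i) = - (centered m i + 1)"
      using centered_reflect[of m i] refl2[of m i] right(1) mn by auto
    have n1: "centered n 1 = - centered n n" by (simp only: ends[OF mn(4)])
    show thesis
    proof (rule that[OF right(2)])
      show "v (i, n) + v (m + 1 - i, 1) + v (i + 1, n) + v (m - i, 1) = 0"
        unfolding v_def vertex_value_def prod.case centered_Suc c n1 anti by simp
      show "par (i, n) \<longleftrightarrow> par (m + 1 - i, 1)" "par (i + 1, n) \<longleftrightarrow> par (m - i, 1)"
        "par (i, n) \<longleftrightarrow> \<not> par (i + 1, n)"
        unfolding par_def even_vertex_def prod.case centered_Suc c n1 by auto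
    qed (use right(1) mn(1,2) in \<open>auto simp: proj_vertices_def\<close>)
  next
    case bottom
    have c: "centered n (n + 1 - j) = - centered n j" "centered n (n - j) = - (centered n j + 1)"
      using centered_reflect[of n j] refl2[of n j] bottom(1) mn by auto
    have m1: "centered m 1 = - centered m m" by (simp only: ends[OF mn(3)])
    show thesis
    proof (rule that[OF bottom(2)])
      show "v (m, j) + v (1, n + 1 - j) + v (m, j + 1) + v (1, n - j) = 0"
        unfolding v_def vertex_value_def prod.case centered_Suc c m1 anti by simp
      show "par (m, j) \<longleftrightarrow> par (1, n + 1 - j)" "par (m, j + 1) \<longleftrightarrow> par (1, n - j)"
        "par (m, j) \<longleftrightarrow> \<not> par (m, j + 1)"
        unfolding par_def even_vertex_def prod.case centered_Suc c m1 by auto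
    qed (use bottom(1) mn(1,2) in \<open>auto simp: proj_vertices_def\<close>)
  qed
qed

lemma even_vertex_value:
  assumes z: "z \<in> parity_pairs m n" and p: "p \<in> proj_vertices m n" and odd: "odd m" "odd n"
  shows "even (vertex_value m n z p) \<longleftrightarrow> even_vertex m n p"
proof -
  obtain i j where ij: "p = (i, j)" by (cases p)
  have "centered m i \<in> cint m" "centered n j \<in> cint n"
    using p bij_betwE[OF bij_betw_centered[OF odd(1)]] bij_betwE[OF bij_betw_centered[OF odd(2)]]
    by (auto simp: ij proj_vertices_def)
  then show ?thesis
    using z by (cases z) (auto simp: ij even_vertex_def parity_pairs_def vertex_value_def signed_sum_def)
qed

text \<open>\<open>P\<close> is a switch. With \<open>False\<close>, \<open>\<phi>\<close> must give
  the constant sum \<open>S\<close> on all quadruples of sum 0. With \<open>True\<close>, this is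
  asked only of those with two even and two odd values, and \<open>z\<close> has to respect
  parity.\<close>

lemma labeling_magic:
  assumes mn: "3 \<le> m" "3 \<le> n" "odd m" "odd n" and z: "z \<in> odd_pairs m n"
    and \<phi>: "bij_betw \<phi> (cint (m * n)) {1..int (m * n)}"
    and par: "P \<Longrightarrow> z \<in> parity_pairs m n"
    and sum0: "\<And>x y u w. x + y + u + w = 0 \<Longrightarrow>
      (P \<Longrightarrow> (even x \<longleftrightarrow> even y) \<and> (even u \<longleftrightarrow> even w) \<and> (even x \<longleftrightarrow> odd u)) \<Longrightarrow>
      \<phi> x + \<phi> y + \<phi> u + \<phi> w = S"
  shows "labeling m n \<phi> z \<in> C4_face_magic_labelings m n"
proof -
  have "sum (labeling m n \<phi> z) F = nat S" if F: "F \<in> proj_C4_faces m n" for F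
  proof -
    let ?v = "vertex_value m n z"
    obtain p q r s where
      pqrs: "F = {p, q, r, s}" "distinct [p, q, r, s]" "{p, q, r, s} \<subseteq> proj_vertices m n"
      and v0: "?v p + ?v q + ?v r + ?v s = 0"
      and pp: "even_vertex m n p \<longleftrightarrow> even_vertex m n q" "even_vertex m n r \<longleftrightarrow> even_vertex m n s"
        "even_vertex m n p \<longleftrightarrow> \<not> even_vertex m n r"
      by (rule face_cases[OF F mn z])
    have "(even (?v p) \<longleftrightarrow> even (?v q)) \<and> (even (?v r) \<longleftrightarrow> even (?v s)) \<and> (even (?v p) \<longleftrightarrow> odd (?v r))" if P
      using even_vertex_value[OF par[OF that] _ mn(3,4)] pp pqrs(3) by simp
    with v0 have S: "\<phi> (?v p) + \<phi> (?v q) + \<phi> (?v r) + \<phi> (?v s) = S" by (intro sum0)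
    have lab: "int (labeling m n \<phi> z x) = \<phi> (?v x)" if "x \<in> proj_vertices m n" for x
    proof -
      have "\<phi> (?v x) \<in> {1..int (m * n)}"
        using bij_betwE[OF bij_betw_vertex_value[OF mn(3,4) z]] bij_betwE[OF \<phi>] that by blast
      then show ?thesis using that by (simp add: labeling_def)
    qed
    have "int (sum (labeling m n \<phi> z) F) = S"
      using pqrs S lab by simp
    then show ?thesis by (metis nat_int)
  qed
  then show ?thesis
    using bij_betw_labeling[OF mn(3,4) z \<phi>]
    by (auto simp: C4_face_magic_labelings_def labeling_def)
qed

section \<open>Injectivity of the construction\<close>

text \<open>At each point both sides carry the same sign, so the unsigned sums agree. Setting
  \<open>j = 0\<close> or \<open>i = 0\<close> isolates \<open>a\<close> or \<open>b\<close>, as all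
  four functions vanish at 0.\<close>

lemma signed_sum_inject:
  assumes z: "z \<in> odd_pairs m n" "z' \<in> odd_pairs m n"
    and eq: "\<And>i j. i \<in> cint m \<Longrightarrow> j \<in> cint n \<Longrightarrow> signed_sum z (i, j) = signed_sum z' (i, j)"
  shows "z = z'"
proof -
  obtain a b a' b' where ab: "z = (a, b)" "z' = (a', b')" by (cases z, cases z')
  note D = odd_pairsD[OF z(1)[unfolded ab]] and D' = odd_pairsD[OF z(2)[unfolded ab]]
  have e: "a i + b j = a' i + b' j" if "i \<in> cint m" "j \<in> cint n" for i j
    using eq[OF that] by (auto simp: ab signed_sum_def split: if_splits)
  have "a i = a' i" for i
    using e[of i 0] D(4,5) D'(4,5) by (cases "i \<in> cint m") auto
  moreover have "b j = b' j" for j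
    using e[of 0 j] D(3,6) D'(3,6) by (cases "j \<in> cint n") auto
  ultimately show ?thesis by (auto simp: ab)
qed

lemma labeling_inject:
  assumes mn: "odd m" "odd n" and z: "z \<in> odd_pairs m n" "z' \<in> odd_pairs m n"
    and \<phi>: "bij_betw \<phi> (cint (m * n)) {1..int (m * n)}"
    and eq: "labeling m n \<phi> z = labeling m n \<phi> z'"
  shows "z = z'"
proof (rule signed_sum_inject[OF z])
  fix i j assume "i \<in> cint m" "j \<in> cint n"
  then obtain k l where kl: "k \<in> {1..m}" "i = centered m k" "l \<in> {1..n}" "j = centered n l"
    using bij_betw_imp_surj_on[OF bij_betw_centered[OF mn(1)]]
      bij_betw_imp_surj_on[OF bij_betw_centered[OF mn(2)]] by blast
  then have p: "(k, l) \<in> proj_vertices m n" by (simp add: proj_vertices_def)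
  let ?x = "vertex_value m n z (k, l)" and ?y = "vertex_value m n z' (k, l)"
  have xy: "?x \<in> cint (m * n)" "?y \<in> cint (m * n)"
    using bij_betwE[OF bij_betw_vertex_value[OF mn z(1)]] bij_betwE[OF bij_betw_vertex_value[OF mn z(2)]] p
    by blast+
  \<comment> \<open>Labels are at least 1, so \<open>nat\<close> does not identify different
    ones.\<close>
  then have "\<phi> ?x \<ge> 1" "\<phi> ?y \<ge> 1" using bij_betwE[OF \<phi>] by auto
  moreover have "nat (\<phi> ?x) = nat (\<phi> ?y)" using fun_cong[OF eq, of "(k, l)"] p by (simp add: labeling_def)
  ultimately have "\<phi> ?x = \<phi> ?y" by simp
  then have "?x = ?y" using xy by (rule inj_onD[OF bij_betw_imp_inj_on[OF \<phi>]])
  then show "signed_sum z (i, j) = signed_sum z' (i, j)" by (simp add: vertex_value_def kl)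
qed

text \<open>The middle vertex has value 0 for every \<open>z\<close>, so its label depends on
  \<open>\<phi>\<close> alone. This tells the families for different \<open>\<phi>\<close>
  apart.\<close>

lemma labeling_center:
  assumes "odd m" "odd n" "z \<in> odd_pairs m n"
  shows "labeling m n \<phi> z (m div 2 + 1, n div 2 + 1) = nat (\<phi> 0)"
proof -
  have "(m div 2 + 1, n div 2 + 1) \<in> proj_vertices m n"
    using assms(1,2) by (auto simp: proj_vertices_def elim!: oddE)
  then show ?thesis
    using odd_pairsD(3,4)[of "fst z" "snd z"] assms(3)
    by (cases z) (auto simp: labeling_def vertex_value_def signed_sum_def centered_def)
qed

text \<open>The relabelings \<open>\<phi>\<close> of the centred values. The second sends even values to the lower
  and odd values to the upper labels, and the third is its complement; both keep faces balanced when a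
  face contains two even and two odd values.\<close>

definition shift_label :: "nat \<Rightarrow> int \<Rightarrow> int" where
  "shift_label k x = int (k div 2) + 1 + x"

definition low_label :: "nat \<Rightarrow> int \<Rightarrow> int" where
  "low_label k x = int (k div 2) div 2 + 1 + x div 2 + (if even x then 0 else int (k div 2) + 1)"

definition high_label :: "nat \<Rightarrow> int \<Rightarrow> int" where
  "high_label k x = int k + 1 - low_label k x"

lemma bij_betw_cintI:
  assumes "odd k" "inj_on \<phi> (cint k)" "\<phi> ` cint k \<subseteq> {1..int k}"
  shows "bij_betw \<phi> (cint k) {1..int k}"
  using card_subset_eq[OF _ assms(3)] assms(1,2)
  by (simp add: bij_betw_def card_image card_cint)

lemma bij_betw_shift_label: "odd k \<Longrightarrow> bij_betw (shift_label k) (cint k) {1..int k}"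
  by (rule bij_betw_cintI) (auto simp: shift_label_def inj_on_def cint_def elim!: oddE)

lemma bij_betw_low_label:
  assumes "odd k"
  shows "bij_betw (low_label k) (cint k) {1..int k}"
proof (rule bij_betw_cintI[OF assms])
  obtain u where u: "k = 2 * u + 1" using assms by (elim oddE)
  have k2: "k div 2 = u" by (simp add: u)
  define K L where "K = int u" and "L = K div 2"
  have low: "low_label k x = L + 1 + x div 2 + (if even x then 0 else K + 1)" for x
    by (simp add: low_label_def k2 K_def L_def)
  have range: "x \<in> cint k \<longleftrightarrow> - K \<le> x \<and> x \<le> K" for x by (auto simp: cint_def k2 K_def)
  have L: "2 * L \<le> K" "K \<le> 2 * L + 1" by (auto simp: L_def)
  have kK: "int k = 2 * K + 1" by (simp add: u K_def)
  \<comment> \<open>The even numbers \<open>2 * y\<close> fill the labels from 1 to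
    \<open>2 * L + 1\<close>, the odd numbers those from \<open>2 * L + 2\<close> to
    \<open>2 * K + 1\<close>. The two shapes of \<open>K\<close> in terms of \<open>L\<close> are
    covered by the bounds on \<open>2 * y\<close>.\<close>
  have halves: "(\<exists>y. x = 2 * y \<and> low_label k x = L + 1 + y \<and> - L \<le> y \<and> y \<le> L) \<or>
      (\<exists>y. x = 2 * y + 1 \<and> low_label k x = L + K + 2 + y \<and> - K - 1 \<le> 2 * y \<and> 2 * y \<le> K - 1)"
    if "x \<in> cint k" for x
  proof (cases "even x")
    case True
    then obtain y where "x = 2 * y" by (elim evenE)
    then show ?thesis using that L by (auto simp: range low)
  next
    case False
    then obtain y where "x = 2 * y + 1" by (elim oddE)
    then show ?thesis using that L by (auto simp: range low)
  qed
  show "inj_on (low_label k) (cint k)"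
  proof (rule inj_onI)
    fix x y assume "x \<in> cint k" "y \<in> cint k" "low_label k x = low_label k y"
    then show "x = y" using halves[of x] halves[of y] L by auto
  qed
  show "low_label k ` cint k \<subseteq> {1..int k}"
  proof
    fix w assume "w \<in> low_label k ` cint k"
    then obtain x where "x \<in> cint k" "w = low_label k x" by auto
    then show "w \<in> {1..int k}" using halves[of x] L kK by auto
  qed
qed

lemma bij_betw_high_label:
  assumes "odd k"
  shows "bij_betw (high_label k) (cint k) {1..int k}"
proof -
  have "bij_betw (\<lambda>y. int k + 1 - y) {1..int k} {1..int k}"
    by (rule bij_betw_byWitness[of _ "\<lambda>y. int k + 1 - y"]) auto
  from bij_betw_trans[OF bij_betw_low_label[OF assms] this]
  have "bij_betw ((\<lambda>y. int k + 1 - y) \<circ> low_label k) (cint k) {1..int k}" .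
  moreover have "(\<lambda>y. int k + 1 - y) \<circ> low_label k = high_label k"
    by (auto simp: high_label_def)
  ultimately show ?thesis by simp
qed

text \<open>Rounding down loses 1/2 at each of the two odd values, so the halves sum to -1. The same
  two values contribute the offset \<open>int (k div 2) + 1\<close> twice.\<close>

lemma sum_low_label:
  assumes "x + y + u + w = 0" "even x \<longleftrightarrow> even y" "even u \<longleftrightarrow> even w" "even x \<longleftrightarrow> odd u"
  shows "low_label k x + low_label k y + low_label k u + low_label k w =
    4 * (int (k div 2) div 2 + 1) + 2 * int (k div 2) + 1"
proof -
  have "x div 2 + y div 2 + u div 2 + w div 2 = - 1" using assms by presburger
  then show ?thesis using assms(2-4) by (cases "even x") (simp_all add: low_label_def)
qed

section \<open>Counting labelings and their symmetry classes\<close>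

lemma finite_C4_face_magic_labelings: "finite (C4_face_magic_labelings m n)"
proof (rule finite_subset)
  show "C4_face_magic_labelings m n \<subseteq> proj_vertices m n \<rightarrow>\<^sub>E {1..m * n}"
    by (auto simp: C4_face_magic_labelings_def PiE_def bij_betw_def)
  show "finite (proj_vertices m n \<rightarrow>\<^sub>E {1..m * n})"
    by (intro finite_PiE) (simp_all add: proj_vertices_def)
qed

lemma card_C4_face_magic_labelings_ge:
  assumes mn: "3 \<le> m" "3 \<le> n" "odd m" "odd n"
  shows "card (odd_pairs m n) + 2 * card (parity_pairs m n) \<le> card (C4_face_magic_labelings m n)"
proof -
  let ?k = "m * n"
  let ?X = "labeling m n (shift_label ?k) ` odd_pairs m n"
  let ?Y = "labeling m n (low_label ?k) ` parity_pairs m n"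
  let ?Z = "labeling m n (high_label ?k) ` parity_pairs m n"
  have k: "odd ?k" using mn by simp
  have sub: "parity_pairs m n \<subseteq> odd_pairs m n" by (auto simp: parity_pairs_def)
  note bij = bij_betw_shift_label[OF k] bij_betw_low_label[OF k] bij_betw_high_label[OF k]
  have inj: "inj_on (labeling m n \<phi>) (odd_pairs m n)" if "bij_betw \<phi> (cint ?k) {1..int ?k}" for \<phi>
    by (rule inj_onI) (rule labeling_inject[OF mn(3,4) _ _ that])
  have card: "card ?X = card (odd_pairs m n)" "card ?Y = card (parity_pairs m n)"
    "card ?Z = card (parity_pairs m n)"
    using inj[OF bij(1)] inj_on_subset[OF inj[OF bij(2)] sub] inj_on_subset[OF inj[OF bij(3)] sub]
    by (simp_all add: card_image)
  \<comment> \<open>The shift turns every quadruple of sum 0 into one of sum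
    \<open>4 * (int (?k div 2) + 1)\<close>, so \<open>P\<close> is taken as
    \<open>False\<close>.\<close>
  have X: "?X \<subseteq> C4_face_magic_labelings m n"
    using labeling_magic[OF mn _ bij(1), of _ False "4 * (int (?k div 2) + 1)"]
    by (auto simp: shift_label_def)
  have Y: "?Y \<subseteq> C4_face_magic_labelings m n"
    using labeling_magic[OF mn _ bij(2), of _ True, OF _ _ sum_low_label[of _ _ _ _ ?k]] sub by blast
  have "high_label ?k x + high_label ?k y + high_label ?k u + high_label ?k w =
      4 * (int ?k + 1) - (4 * (int (?k div 2) div 2 + 1) + 2 * int (?k div 2) + 1)"
    if "x + y + u + w = 0" "even x \<longleftrightarrow> even y" "even u \<longleftrightarrow> even w" "even x \<longleftrightarrow> odd u" for x y u w
    using sum_low_label[OF that, of ?k] by (simp add: high_label_def)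
  from labeling_magic[OF mn _ bij(3), of _ True, OF _ _ this] sub
  have Z: "?Z \<subseteq> C4_face_magic_labelings m n" by blast
  \<comment> \<open>The label of the middle vertex separates the three families: with
    \<open>K = ?k div 2\<close> it is \<open>K + 1\<close>, \<open>K div 2 + 1\<close> and
    \<open>2 * K + 1 - K div 2\<close>, respectively.\<close>
  define c where "c f = f (m div 2 + 1, n div 2 + 1)" for f :: "nat \<times> nat \<Rightarrow> nat"
  have "9 \<le> ?k" using mult_le_mono[OF mn(1,2)] by simp
  then have k4: "4 \<le> ?k div 2" by presburger
  have cX: "c f = nat (shift_label ?k 0)" if "f \<in> ?X" for f
    using that labeling_center[OF mn(3,4)] by (auto simp: c_def)
  have cY: "c f = nat (low_label ?k 0)" if "f \<in> ?Y" for f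
    using that sub labeling_center[OF mn(3,4)] by (auto simp: c_def)
  have cZ: "c f = nat (high_label ?k 0)" if "f \<in> ?Z" for f
    using that sub labeling_center[OF mn(3,4)] by (auto simp: c_def)
  have ne: "nat (shift_label ?k 0) \<noteq> nat (low_label ?k 0)" "nat (shift_label ?k 0) \<noteq> nat (high_label ?k 0)"
    "nat (low_label ?k 0) \<noteq> nat (high_label ?k 0)"
  proof -
    have "int ?k = 2 * int (?k div 2) + 1" using k by (metis odd_two_times_div_two_succ of_nat_add of_nat_mult of_nat_numeral of_nat_1)
    moreover define K where "K = int (?k div 2)"
    ultimately have "shift_label ?k 0 = K + 1" "low_label ?k 0 = K div 2 + 1" "high_label ?k 0 = 2 * K + 1 - K div 2"
      by (simp_all add: shift_label_def low_label_def high_label_def)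
    moreover have "4 \<le> K" using k4 by (simp add: K_def)
    ultimately show "nat (shift_label ?k 0) \<noteq> nat (low_label ?k 0)" "nat (shift_label ?k 0) \<noteq> nat (high_label ?k 0)"
      "nat (low_label ?k 0) \<noteq> nat (high_label ?k 0)"
      by linarith+
  qed
  have disj: "?X \<inter> ?Y = {}" "(?X \<union> ?Y) \<inter> ?Z = {}"
  proof -
    have "False" if "f \<in> ?X" "f \<in> ?Y" for f using cX[OF that(1)] cY[OF that(2)] ne(1) by argo
    then show "?X \<inter> ?Y = {}" by blast
    have "False" if "f \<in> ?X" "f \<in> ?Z" for f using cX[OF that(1)] cZ[OF that(2)] ne(2) by argo
    moreover have "False" if "f \<in> ?Y" "f \<in> ?Z" for f using cY[OF that(1)] cZ[OF that(2)] ne(3) by argo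
    ultimately show "(?X \<union> ?Y) \<inter> ?Z = {}" by blast
  qed
  have fin: "finite ?X" "finite ?Y" "finite ?Z"
    using finite_odd_pairs finite_subset[OF sub] by simp_all
  have "card (odd_pairs m n) + 2 * card (parity_pairs m n) = card (?X \<union> ?Y \<union> ?Z)"
    using card disj fin by (simp add: card_Un_disjoint)
  also have "\<dots> \<le> card (C4_face_magic_labelings m n)"
    using X Y Z by (intro card_mono finite_C4_face_magic_labelings) simp
  finally show ?thesis .
qed

text \<open>Every class arises from one labeling by the four symmetries, so it has at most four
  elements. The identity puts each labeling into some class, so the classes cover
  everything.\<close>

lemma card_C4_face_magic_labelings_le:
  "card (C4_face_magic_labelings m n) \<le> 4 * num_C4_face_magic_labelings m n"
proof -
  let ?C = "C4_face_magic_labelings m n" and ?R = "symmetry_equiv m n"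
  have finC: "finite ?C" by (rule finite_C4_face_magic_labelings)
  have fin: "finite (?C // ?R)" using finC by (auto simp: quotient_def)
  have le4: "card E \<le> 4 \<and> finite E" if "E \<in> ?C // ?R" for E
  proof -
    from that obtain f where "E = ?R `` {f}" by (auto simp: quotient_def)
    then have "E \<subseteq> (\<lambda>\<sigma>. restrict (f \<circ> \<sigma>) (proj_vertices m n)) ` proj_symmetries m n"
      by (auto simp: symmetry_equiv_def)
    moreover have "card (proj_symmetries m n) \<le> 4"
      unfolding proj_symmetries_def by (intro card_insert_le_m1) simp_all
    moreover have "finite (proj_symmetries m n)" by (simp add: proj_symmetries_def)
    ultimately show ?thesis
      by (meson card_image_le card_mono finite_imageI finite_subset order_trans)
  qed
  have "?C \<subseteq> \<Union> (?C // ?R)"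
  proof
    fix f assume f: "f \<in> ?C"
    then have "f \<in> extensional (proj_vertices m n)" by (simp add: C4_face_magic_labelings_def)
    \<comment> \<open>Extensionality makes the restriction give back \<open>f\<close>
      itself.\<close>
    then have "restrict (f \<circ> (\<lambda>(i, j). (i, j))) (proj_vertices m n) = f"
      by (auto simp: fun_eq_iff restrict_def extensional_def)
    then have "(f, f) \<in> ?R"
      using f unfolding symmetry_equiv_def proj_symmetries_def by auto
    with f show "f \<in> \<Union> (?C // ?R)" by (auto simp: quotient_def)
  qed
  then have "card ?C \<le> card (\<Union> (?C // ?R))"
    using fin le4 by (intro card_mono) auto
  also have "\<dots> \<le> (\<Sum>E\<in>?C // ?R. card E)"
    by (rule card_Union_le_sum_card)
  also have "\<dots> \<le> (\<Sum>E\<in>?C // ?R. 4)"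
    using le4 by (intro sum_mono) simp
  finally show ?thesis by (simp add: num_C4_face_magic_labelings_def mult.commute)
qed

theorem theorem44:
  fixes m n :: nat
  assumes "m \<ge> 3" and "n \<ge> 3" and "odd m" and "odd n" and "m \<noteq> n"
  shows "real (num_C4_face_magic_labelings m n) \<ge>
    (real (tau m n) + real (tau n m)) * 2 powr (real m / 2 + real n / 2 - 3) *
    (fact ((m - 1) div 2) * fact ((n - 1) div 2) + 2 * real (beta m) * real (beta n))"
proof -
  define M N where "M = m div 2" and "N = n div 2"
  have m: "m = 2 * M + 1" and n: "n = 2 * N + 1" using assms by (auto simp: M_def N_def)
  let ?t = "tau m n + tau n m"
  \<comment> \<open>Parity pairs count twice more, once for \<open>low_label\<close> and once for
    \<open>high_label\<close>.\<close>
  have "?t * ((2 ^ M * fact M) * (2 ^ N * fact N)) + 2 * (?t * ((2 ^ M * beta m) * (2 ^ N * beta n)))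
      \<le> card (odd_pairs m n) + 2 * card (parity_pairs m n)"
    using card_odd_pairs_ge[of m n] card_parity_pairs_ge[of m n] assms
    unfolding M_def N_def by (intro add_mono mult_left_mono) auto
  also have "\<dots> \<le> 4 * num_C4_face_magic_labelings m n"
    using card_C4_face_magic_labelings_ge[of m n] card_C4_face_magic_labelings_le[of m n] assms by linarith
  finally have "?t * 2 ^ (M + N) * (fact M * fact N + 2 * beta m * beta n)
      \<le> 4 * num_C4_face_magic_labelings m n"
    by (simp add: algebra_simps power_add)
  then have "real (?t * 2 ^ (M + N) * (fact M * fact N + 2 * beta m * beta n))
      \<le> real (4 * num_C4_face_magic_labelings m n)"
    by (simp only: of_nat_le_iff)
  then have *: "(real (tau m n) + real (tau n m)) * 2 ^ (M + N) *
      (fact M * fact N + 2 * real (beta m) * real (beta n)) / 4 \<le> real (num_C4_face_magic_labelings m n)"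
    by simp
  \<comment> \<open>The two halves add up to \<open>M + N + 1\<close>, which leaves
    \<open>M + N - 2\<close>; the -2 is the factor 1/4 from the size of the classes.\<close>
  have "real m / 2 + real n / 2 - 3 = real (M + N) - 2" by (simp add: m n field_simps)
  then have "2 powr (real m / 2 + real n / 2 - 3) = 2 powr real (M + N) / 2 powr 2"
    by (simp only: powr_diff)
  also have "\<dots> = 2 ^ (M + N) / 4" by (subst powr_realpow) simp_all
  finally have "2 powr (real m / 2 + real n / 2 - 3) = 2 ^ (M + N) / (4 :: real)" .
  moreover have "(m - 1) div 2 = M" "(n - 1) div 2 = N" by (simp_all add: m n)
  ultimately show ?thesis using * by (simp only: times_divide_eq_right times_divide_eq_left)
qed

end
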